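(* Let $\Bbbk$ be a field, $\Delta$ a nonempty simplicial complex on $[n]=\{1,\ldots,n\}$ and $\Bbbk[\Delta]$ its face ring. Then $$\mathrm{BW}(\Bbbk[\Delta];t,w)=\sum_{i,j} f_{i,j}(\Delta)\,w^i t^j(1-t)^{i-j}.$$ In particular, for all $0\le j\le i\le \dim\Delta+1$, $h_{i,j}(\Delta)$ is the coefficient of $w^it^j$ in $\mathrm{BW}(\Bbbk[\Delta];t,w)$.
   Context: A simplicial complex on $[n]$ is a set $\Delta$ of subsets (faces) of $[n]$ closed under passing to subsets; $\dim F=|F|-1$ and $\dim \Delta=\max_{F\in\Delta}\dim F$. With $R=\Bbbk[x_1,\ldots,x_n]$ (standard grading), the Stanley–Reisner ideal $I_\Delta$ is generated by the monomials $x_G=\prod_{i\in G}x_i$ with $G\subseteq [n]$, $G\notin\Delta$, and the face ring is $\Bbbk[\Delta]=R/I_\Delta$, of Krull dimension $\dim\Delta+1$. The degree of a face $\sigma\in\Delta$ is the largest cardinality of a face of $\Delta$ containing $\sigma$; $f_{i,j}(\Delta)$ is the number of faces of $\Delta$ of degree $i$ and cardinality $j$. The doubly indexed $h$-numbers are $h_{i,j}(\Delta)=\sum_k(-1)^{j-k}\binom{i-k}{j-k}f_{i,k}(\Delta)$ (sum over $0\le k\le j$). Björner–Wachs polynomial: let $I\subsetneq R$ be a homogeneous ideal, $A=R/I$, $d=\dim A$, $I=\bigcap_j\mathfrak q_j$ a reduced primary decomposition and $\mathfrak p_j=\sqrt{\mathfrak q_j}$. Put $I^{\langle i\rangle}=\bigcap_{\dim(R/\mathfrak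 p_j)>i}\mathfrak q_j$ for $-1\le i\le d$ (empty intersection $=R$; so $I^{\langle -1\rangle}=I$, $I^{\langle d\rangle}=R$); these ideals do not depend on the decomposition. Let $U_i(A)=I^{\langle i\rangle}/I^{\langle i-1\rangle}$ for $0\le i\le d$; it is zero or of Krull dimension $i$. Define $\mathrm h(U_i(A);t)\in\mathbb Z[t]$ by $\sum_j\dim_\Bbbk (U_i(A)_j)\,t^j=\mathrm h(U_i(A);t)/(1-t)^i$ (so it is $0$ if $U_i(A)=0$). Then $\mathrm{BW}(A;t,w)=\sum_{i=0}^d\mathrm h(U_i(A);t)\,w^i$. *)

theory Defs
  imports
    "HOL-Algebra.Embedded_Algebras"
    "HOL-Algebra.QuotRing"
    "HOL-Library.Poly_Mapping"
    "HOL-Library.Extended_Nat"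
    "HOL-Computational_Algebra.Polynomial_FPS"
begin

section \<open>Simplicial complexes and their face numbers\<close>

definition simplicial_complex :: "nat \<Rightarrow> nat set set \<Rightarrow> bool" where
  "simplicial_complex n \<Delta> \<longleftrightarrow>
     (\<forall>F\<in>\<Delta>. F \<subseteq> {1..n}) \<and> (\<forall>F\<in>\<Delta>. \<forall>G. G \<subseteq> F \<longrightarrow> G \<in> \<Delta>)"

text \<open>Integer valued, since the complex whose only face is the empty set has dimension \<open>-1\<close>.\<close>

definition complex_dim :: "nat set set \<Rightarrow> int" where
  "complex_dim \<Delta> = Max ((\<lambda>F. int (card F) - 1) ` \<Delta>)"

definition face_degree :: "nat set set \<Rightarrow> nat set \<Rightarrow> nat" where
  "face_degree \<Delta> \<sigma> = Max (card ` {F\<in>\<Delta>. \<sigma> \<subseteq> F})"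

definition f_number :: "nat set set \<Rightarrow> nat \<Rightarrow> nat \<Rightarrow> nat" where
  "f_number \<Delta> i j = card {\<sigma>\<in>\<Delta>. face_degree \<Delta> \<sigma> = i \<and> card \<sigma> = j}"

text \<open>The truncated difference \<open>i - k\<close> is harmless: a face of degree \<open>i\<close> has at most \<open>i\<close>
  elements, so the summands with \<open>k > i\<close> vanish.\<close>

definition h_number :: "nat set set \<Rightarrow> nat \<Rightarrow> nat \<Rightarrow> int" where
  "h_number \<Delta> i j =
     (\<Sum>k\<le>j. (- 1) ^ (j - k) * int ((i - k) choose (j - k)) * int (f_number \<Delta> i k))"


section \<open>Krull dimension and primary decomposition\<close>

text \<open>The supremum of the lengths of chains of prime ideals. (It is \<open>0\<close> for the zero ring,
  to which it is not applied below.)\<close>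

definition krull_dim :: "('a, 'b) ring_scheme \<Rightarrow> enat" where
  "krull_dim R =
     (SUP l \<in> {l. \<exists>P. (\<forall>k\<le>l. primeideal (P k) R) \<and> (\<forall>k<l. P k \<subset> P (Suc k))}. enat l)"

definition radical_ideal :: "('a, 'b) ring_scheme \<Rightarrow> 'a set \<Rightarrow> 'a set" where
  "radical_ideal R I = {x \<in> carrier R. \<exists>m::nat. 0 < m \<and> x [^]\<^bsub>R\<^esub> m \<in> I}"

definition primary_ideal :: "'a set \<Rightarrow> ('a, 'b) ring_scheme \<Rightarrow> bool" where
  "primary_ideal Q R \<longleftrightarrow> ideal Q R \<and> Q \<noteq> carrier R \<and>
     (\<forall>a\<in>carrier R. \<forall>b\<in>carrier R. a \<otimes>\<^bsub>R\<^esub> b \<in> Q \<longrightarrow> a \<in> Q \<or> b \<in> radical_ideal R Q)"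

text \<open>Intersecting with the carrier makes the empty intersection equal to the whole ring.\<close>

definition ideal_Inter :: "('a, 'b) ring_scheme \<Rightarrow> 'a set set \<Rightarrow> 'a set" where
  "ideal_Inter R \<Q> = carrier R \<inter> \<Inter>\<Q>"

definition reduced_primary_decomposition ::
    "('a, 'b) ring_scheme \<Rightarrow> 'a set \<Rightarrow> 'a set set \<Rightarrow> bool" where
  "reduced_primary_decomposition R I \<Q> \<longleftrightarrow>
     finite \<Q> \<and> (\<forall>Q\<in>\<Q>. primary_ideal Q R) \<and> I = ideal_Inter R \<Q> \<and>
     inj_on (radical_ideal R) \<Q> \<and> (\<forall>Q\<in>\<Q>. \<not> ideal_Inter R (\<Q> - {Q}) \<subseteq> Q)"

text \<open>The ideal \<open>I\<^sup>\<langle>\<^sup>i\<^sup>\<rangle>\<close>. The description operator expresses that it is the common value for all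
  reduced primary decompositions of \<open>I\<close>. The use of \<open>the_enat\<close> presumes that the rings \<open>R/radical Q\<close> have finite
  dimension, as is the case for finitely generated algebras over a field.\<close>

definition dim_filtration :: "('a, 'b) ring_scheme \<Rightarrow> 'a set \<Rightarrow> int \<Rightarrow> 'a set" where
  "dim_filtration R I i =
     (THE J. \<exists>\<Q>. reduced_primary_decomposition R I \<Q> \<and>
        J = ideal_Inter R {Q\<in>\<Q>. int (the_enat (krull_dim (R Quot radical_ideal R Q))) > i})"


section \<open>The polynomial ring and the Stanley--Reisner ideal\<close>

text \<open>A monomial is its exponent vector \<open>nat \<Rightarrow>\<^sub>0 nat\<close>; the variable \<open>x\<^sub>i\<close> has index \<open>i\<close>.\<close>

type_synonym 'k mpoly = "(nat \<Rightarrow>\<^sub>0 nat) \<Rightarrow>\<^sub>0 'k"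

definition poly_ring :: "nat \<Rightarrow> 'k::field mpoly ring" where
  "poly_ring n =
     \<lparr>carrier = {p. \<forall>m\<in>Poly_Mapping.keys p. Poly_Mapping.keys m \<subseteq> {1..n}},
      monoid.mult = (*), one = 1, zero = 0, add = (+)\<rparr>"

definition mconst :: "'k::field \<Rightarrow> 'k mpoly" where
  "mconst c = Poly_Mapping.single 0 c"

definition mvar :: "nat \<Rightarrow> 'k::field mpoly" where
  "mvar i = Poly_Mapping.single (Poly_Mapping.single i 1) 1"

definition monomial_degree :: "(nat \<Rightarrow>\<^sub>0 nat) \<Rightarrow> nat" where
  "monomial_degree m = (\<Sum>i\<in>Poly_Mapping.keys m. Poly_Mapping.lookup m i)"

definition graded_piece :: "nat \<Rightarrow> nat \<Rightarrow> 'k::field mpoly set" where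
  "graded_piece n j =
     {p \<in> carrier (poly_ring n). \<forall>m\<in>Poly_Mapping.keys p. monomial_degree m = j}"

definition stanley_reisner_ideal :: "nat \<Rightarrow> nat set set \<Rightarrow> 'k::field mpoly set" where
  "stanley_reisner_ideal n \<Delta> =
     genideal (poly_ring n) {\<Prod>i\<in>G. mvar i | G. G \<subseteq> {1..n} \<and> G \<notin> \<Delta>}"

lemma cring_poly_ring: "cring (poly_ring n :: 'k::field mpoly ring)"
proof (rule cringI)
  let ?R = "poly_ring n :: 'k mpoly ring"
  have plus: "x + y \<in> carrier ?R" if "x \<in> carrier ?R" "y \<in> carrier ?R" for x y
    using that Poly_Mapping.keys_add[of x y] unfolding poly_ring_def by simp blast
  have times: "x * y \<in> carrier ?R" if x: "x \<in> carrier ?R" and y: "y \<in> carrier ?R" for x y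
  proof -
    have "Poly_Mapping.keys m \<subseteq> {1..n}" if "m \<in> Poly_Mapping.keys (x * y)" for m
    proof -
      from keys_mult[of x y] that obtain a b
        where "m = a + b" "a \<in> Poly_Mapping.keys x" "b \<in> Poly_Mapping.keys y"
        by blast
      moreover have "Poly_Mapping.keys (a + b) \<subseteq> Poly_Mapping.keys a \<union> Poly_Mapping.keys b"
        by (rule Poly_Mapping.keys_add)
      ultimately show ?thesis
        using x y unfolding poly_ring_def by simp blast
    qed
    then show ?thesis unfolding poly_ring_def by simp
  qed
  have uminus: "- x \<in> carrier ?R" if "x \<in> carrier ?R" for x
    using that by (simp add: poly_ring_def)
  have zero: "0 \<in> carrier ?R" and one: "1 \<in> carrier ?R"
    by (simp_all add: poly_ring_def)
  have ops: "add ?R = (+)" "monoid.mult ?R = (*)" "ring.zero ?R = 0" "monoid.one ?R = 1"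
    by (simp_all add: poly_ring_def)
  show "abelian_group ?R"
  proof (rule abelian_groupI, unfold ops)
    fix x assume "x \<in> carrier ?R"
    then show "\<exists>y\<in>carrier ?R. y + x = 0"
      using uminus by (intro bexI[of _ "- x"]) simp_all
  qed (simp_all add: plus zero ac_simps)
  show "Group.comm_monoid ?R"
    by (rule comm_monoidI; unfold ops) (simp_all add: times one ac_simps)
  show "(x \<oplus>\<^bsub>?R\<^esub> y) \<otimes>\<^bsub>?R\<^esub> z = x \<otimes>\<^bsub>?R\<^esub> z \<oplus>\<^bsub>?R\<^esub> y \<otimes>\<^bsub>?R\<^esub> z" for x y z
    unfolding ops by (rule distrib_right)
qed


section \<open>The Bjoerner--Wachs polynomial\<close>

text \<open>In this section \<open>I\<close> is a proper homogeneous ideal of \<open>R = poly_ring n\<close>, and \<open>A = R/I\<close>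
  is given by this presentation.

  The degree \<open>j\<close> part of \<open>U\<^sub>i(A)\<close>, for \<open>0 \<le> i \<le> dim A\<close>, as a set of cosets in the ring
  \<open>R Quot dim_filtration R I (i - 1)\<close>.\<close>

definition U_piece :: "nat \<Rightarrow> 'k::field mpoly set \<Rightarrow> nat \<Rightarrow> nat \<Rightarrow> 'k mpoly set set" where
  "U_piece n I i j =
     (\<lambda>p. dim_filtration (poly_ring n) I (int i - 1) +>\<^bsub>poly_ring n\<^esub> p) `
       (dim_filtration (poly_ring n) I (int i) \<inter> graded_piece n j)"

text \<open>Its dimension over the field, which embeds into the quotient ring (nonzero for
  \<open>i \<le> dim A\<close>) as the cosets of the constants.\<close>

definition U_dim :: "nat \<Rightarrow> 'k::field mpoly set \<Rightarrow> nat \<Rightarrow> nat \<Rightarrow> nat" where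
  "U_dim n I i j =
     (let J = dim_filtration (poly_ring n) I (int i - 1)
      in ring.dim (poly_ring n Quot J) (range (\<lambda>c. J +>\<^bsub>poly_ring n\<^esub> mconst c)) (U_piece n I i j))"

definition h_U :: "nat \<Rightarrow> 'k::field mpoly set \<Rightarrow> nat \<Rightarrow> int poly" where
  "h_U n I i =
     (THE h. Abs_fps (\<lambda>j. int (U_dim n I i j)) * (1 - fps_X) ^ i = fps_of_poly h)"

text \<open>Polynomials in \<open>t\<close> and \<open>w\<close> are elements of \<open>\<int>[t][w]\<close>.\<close>

abbreviation t_var :: "int poly poly" where "t_var \<equiv> [:[:0, 1:]:]"
abbreviation w_var :: "int poly poly" where "w_var \<equiv> [:0, 1:]"

definition BW :: "nat \<Rightarrow> 'k::field mpoly set \<Rightarrow> int poly poly" where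
  "BW n I = (\<Sum>i\<le>the_enat (krull_dim (poly_ring n Quot I)). [:h_U n I i:] * w_var ^ i)"

end

theory Submission
  imports Defs
begin

text \<open>The Stanley--Reisner ideal is the irredundant intersection of the monomial primes \<open>P\<^sub>F\<close> generated
  by the variables outside a facet \<open>F\<close>, and a radical ideal with finitely many incomparable minimal
  primes has only this one reduced primary decomposition. Since \<open>R/P\<^sub>F\<close> has dimension \<open>card F\<close>, the
  degree \<open>j\<close> part of \<open>U\<^sub>i\<close> has as basis the monomials of degree \<open>j\<close> whose support is a face of degree
  \<open>i\<close>. The monomials with support \<open>\<sigma>\<close> have generating function \<open>(t/(1 - t))\<^bsup>card \<sigma>\<^esup>\<close>; multiplying by
  \<open>(1 - t)\<^sup>i\<close> gives the formula. The dimension of \<open>R/P\<^sub>F\<close> is bounded by choosing an element in each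
  step of a chain of primes: these elements are algebraically independent, and a count of their
  power products against the monomials supported on \<open>F\<close> bounds their number by \<open>card F\<close>.\<close>

section \<open>Reduced primary decompositions of intersections of primes\<close>

text \<open>\<open>dim_filtration\<close> is a description over all reduced primary decompositions,
  so arbitrary primary components have to be excluded before any concrete ideal can be computed.
  Once this is done, every ideal in play is spanned by monomials and encoded by a family of sets;
  stage \<open>i\<close> of the filtration belongs to the faces with more than \<open>i\<close>
  elements. A monomial is therefore nonzero in \<open>U\<^sub>i\<close> exactly if some face of size
  at least \<open>i\<close>, but none of larger size, contains its support, which is where the
  degree of a face enters. The remaining obstacle is the upper bound for the dimension, since chains
  may consist of arbitrary primes. For a chain of length \<open>l\<close> above
  \<open>P\<^sub>F\<close>, the chosen elements can be taken with support in \<open>F\<close> and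
  exponents at most some \<open>e\<close>. Their \<open>(M + 1) ^ l\<close> power products with
  exponents at most \<open>M\<close> lie in the span of at most
  \<open>(1 + l * M * e) ^ card F\<close> monomials. Letting \<open>M\<close> grow gives
  \<open>l \<le> card F\<close>.\<close>

lemma (in cring) primeideal_ideal_Inter:
  assumes P: "primeideal P R" and "finite \<Q>" and "\<And>Q. Q \<in> \<Q> \<Longrightarrow> ideal Q R"
    and "ideal_Inter R \<Q> \<subseteq> P"
  shows "\<exists>Q\<in>\<Q>. Q \<subseteq> P"
  using assms(2-4)
proof (induction \<Q> rule: finite_induct)
  case empty
  interpret primeideal P R by fact
  show ?case
    using empty I_notcarr a_subset by (auto simp: ideal_Inter_def)
next
  case (insert Q \<Q>)
  interpret primeideal P R by fact
  interpret Q: ideal Q R using insert.prems by simp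
  show ?case
  proof (cases "Q \<subseteq> P")
    case False
    then obtain q where q: "q \<in> Q" "q \<notin> P" by blast
    \<comment> \<open>The witness \<open>q\<close> multiplies the intersection of the other ideals
      into \<open>P\<close>; as \<open>q\<close> is outside \<open>P\<close>, primeness puts that
      whole intersection into \<open>P\<close>.\<close>
    have "x \<in> P" if x: "x \<in> ideal_Inter R \<Q>" for x
    proof -
      have xc: "x \<in> carrier R" using x by (simp add: ideal_Inter_def)
      have "q \<otimes> x \<in> ideal_Inter R (insert Q \<Q>)"
        using x xc q insert.prems(1) by (auto simp: ideal_Inter_def Q.I_r_closed intro: ideal.I_l_closed)
      then have "q \<otimes> x \<in> P" using insert.prems by blast
      then show "x \<in> P" using I_prime[of q x] q xc by auto
    qed
    then show ?thesis using insert by blast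
  qed simp
qed

lemma (in cring) primeideal_nat_pow:
  assumes P: "primeideal P R" and "x \<in> carrier R" and "x [^] (m::nat) \<in> P"
  shows "x \<in> P"
  using assms(3)
proof (induction m)
  case 0
  interpret primeideal P R by fact
  show ?case using 0 I_notcarr one_imp_carrier by simp
next
  case (Suc m)
  interpret primeideal P R by fact
  show ?case using Suc assms(2) I_prime[of "x [^] m" x] by auto
qed

lemma (in cring) radical_ideal_superset:
  "ideal I R \<Longrightarrow> I \<subseteq> radical_ideal R I"
  unfolding radical_ideal_def
  by (auto simp: ideal.Icarr intro!: exI[of _ "1::nat"])

lemma (in cring) radical_ideal_primeideal:
  assumes "primeideal P R"
  shows "radical_ideal R P = P"
proof
  show "P \<subseteq> radical_ideal R P"
    using assms radical_ideal_superset primeideal.axioms(1) by blast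
  show "radical_ideal R P \<subseteq> P"
    using primeideal_nat_pow[OF assms] by (auto simp: radical_ideal_def)
qed

lemma (in cring) primary_ideal_primeideal:
  assumes "primeideal P R"
  shows "primary_ideal P R"
proof -
  interpret primeideal P R by fact
  show ?thesis
    unfolding primary_ideal_def radical_ideal_primeideal[OF assms]
    using is_ideal I_notcarr I_prime by blast
qed

text \<open>That the radical is an ideal is taken as a hypothesis: in the application it has already
  been identified with an intersection of primes, which avoids expanding powers of sums.\<close>

lemma (in cring) primeideal_radical_ideal:
  assumes Q: "primary_ideal Q R" and rad: "ideal (radical_ideal R Q) R"
  shows "primeideal (radical_ideal R Q) R"
proof (rule primeidealI[OF rad is_cring])
  interpret Q: ideal Q R using Q by (simp add: primary_ideal_def)
  have "\<one> \<notin> Q" using Q Q.one_imp_carrier by (auto simp: primary_ideal_def)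
  then have "\<one> \<notin> radical_ideal R Q" by (auto simp: radical_ideal_def)
  then show "carrier R \<noteq> radical_ideal R Q" by blast
  fix a b assume ab: "a \<in> carrier R" "b \<in> carrier R" "a \<otimes> b \<in> radical_ideal R Q"
  then obtain m :: nat where m: "m > 0" "(a \<otimes> b) [^] m \<in> Q"
    by (auto simp: radical_ideal_def)
  then have "a [^] m \<otimes> b [^] m \<in> Q"
    using ab by (simp add: nat_pow_distrib)
  then consider "a [^] m \<in> Q" | "b [^] m \<in> radical_ideal R Q"
    using Q ab unfolding primary_ideal_def by blast
  then show "a \<in> radical_ideal R Q \<or> b \<in> radical_ideal R Q"
  proof cases
    case 1
    then show ?thesis using m ab by (auto simp: radical_ideal_def)
  next
    case 2
    then obtain k :: nat where "k > 0" "(b [^] m) [^] k \<in> Q"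
      by (auto simp: radical_ideal_def)
    then have "b \<in> radical_ideal R Q"
      using m(1) ab unfolding radical_ideal_def
      by (auto simp: nat_pow_pow intro!: exI[of _ "m * k"])
    then show ?thesis ..
  qed
qed

lemma (in cring) ideal_ideal_Inter:
  assumes "\<And>Q. Q \<in> \<Q> \<Longrightarrow> ideal Q R"
  shows "ideal (ideal_Inter R \<Q>) R"
proof (cases "\<Q> = {}")
  case True
  then show ?thesis using oneideal by (simp add: ideal_Inter_def)
next
  case False
  then have "ideal_Inter R \<Q> = \<Inter>\<Q>"
    using assms ideal.Icarr by (fastforce simp: ideal_Inter_def)
  then show ?thesis using i_Intersect[of \<Q>] assms False by simp
qed

text \<open>The radical of a component \<open>Q\<close> of a reduced decomposition of \<open>I = \<Inter>\<P>\<close> is the colon ideal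
  \<open>(I : x)\<close> for any \<open>x\<close> outside \<open>Q\<close> that lies in all other components, and \<open>(I : x)\<close> is the
  intersection of the members of \<open>\<P>\<close> not containing \<open>x\<close>.\<close>

lemma (in cring) reduced_primary_decomposition_primes_iff:
  assumes fin: "finite \<P>" and prime: "\<And>P. P \<in> \<P> \<Longrightarrow> primeideal P R"
    and incomp: "\<And>P P'. \<lbrakk>P \<in> \<P>; P' \<in> \<P>; P \<subseteq> P'\<rbrakk> \<Longrightarrow> P = P'"
  shows "reduced_primary_decomposition R (ideal_Inter R \<P>) \<Q> \<longleftrightarrow> \<Q> = \<P>"
proof
  have idealP: "ideal P R" if "P \<in> \<P>" for P using prime[OF that] by (rule primeideal.axioms(1))
  \<comment> \<open>If the other members intersected inside \<open>P\<close>, one of them would lie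
    in \<open>P\<close>, against incomparability.\<close>
  have irred: "\<not> ideal_Inter R (\<P> - {P}) \<subseteq> P" if "P \<in> \<P>" for P
    using primeideal_ideal_Inter[OF prime[OF that], of "\<P> - {P}"] fin idealP incomp that by blast
  {
    assume "\<Q> = \<P>"
    then show "reduced_primary_decomposition R (ideal_Inter R \<P>) \<Q>"
      using fin irred prime unfolding reduced_primary_decomposition_def
      by (auto simp: primary_ideal_primeideal radical_ideal_primeideal inj_on_def)
  next
    assume red: "reduced_primary_decomposition R (ideal_Inter R \<P>) \<Q>"
    then have finQ: "finite \<Q>" and prim: "\<And>Q. Q \<in> \<Q> \<Longrightarrow> primary_ideal Q R"
      and eq: "ideal_Inter R \<P> = ideal_Inter R \<Q>"
      and irredQ: "\<And>Q. Q \<in> \<Q> \<Longrightarrow> \<not> ideal_Inter R (\<Q> - {Q}) \<subseteq> Q"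
      unfolding reduced_primary_decomposition_def by auto
    have idealQ: "ideal Q R" if "Q \<in> \<Q>" for Q using prim[OF that] by (simp add: primary_ideal_def)
    have rad: "radical_ideal R Q \<in> \<P>" if Q: "Q \<in> \<Q>" for Q
    proof -
      obtain x where x: "x \<in> ideal_Inter R (\<Q> - {Q})" "x \<notin> Q" using irredQ[OF Q] by blast
      have xc: "x \<in> carrier R" using x by (simp add: ideal_Inter_def)
      define \<P>' where "\<P>' = {P \<in> \<P>. x \<notin> P}"
      have sup: "y \<in> radical_ideal R Q" if y: "y \<in> ideal_Inter R \<P>'" for y
      proof -
        have yc: "y \<in> carrier R" using y by (simp add: ideal_Inter_def)
        have "x \<otimes> y \<in> ideal_Inter R \<P>"
          using y yc xc ideal.I_r_closed[OF idealP] ideal.I_l_closed[OF idealP]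
          by (auto simp: ideal_Inter_def \<P>'_def)
        then have "x \<otimes> y \<in> Q" using Q unfolding eq by (auto simp: ideal_Inter_def)
        then show ?thesis using prim[OF Q] xc yc x(2) by (auto simp: primary_ideal_def)
      qed
      have sub: "y \<in> ideal_Inter R \<P>'" if y: "y \<in> radical_ideal R Q" for y
      proof -
        obtain m :: nat where yc: "y \<in> carrier R" and m: "y [^] m \<in> Q"
          using y by (auto simp: radical_ideal_def)
        have "x \<otimes> y [^] m \<in> ideal_Inter R \<Q>"
          using x xc yc m ideal.I_r_closed[OF idealQ] ideal.I_l_closed[OF idealQ] Q
          unfolding ideal_Inter_def by blast
        then have "x \<otimes> y [^] m \<in> P" if "P \<in> \<P>" for P
          using that unfolding eq[symmetric] by (auto simp: ideal_Inter_def)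
        then have "y \<in> P" if "P \<in> \<P>'" for P
          using that primeideal.I_prime[OF prime, of P x "y [^] m"] xc yc
            primeideal_nat_pow[OF prime, of P y m] unfolding \<P>'_def by blast
        then show ?thesis using yc by (auto simp: ideal_Inter_def)
      qed
      have radeq: "radical_ideal R Q = ideal_Inter R \<P>'" using sup sub by blast
      have "ideal (radical_ideal R Q) R"
        unfolding radeq by (rule ideal_ideal_Inter) (auto simp: \<P>'_def idealP)
      then have "primeideal (radical_ideal R Q) R"
        by (rule primeideal_radical_ideal[OF prim[OF Q]])
      \<comment> \<open>A prime that is a finite intersection of ideals contains one of them, and
        that one contains the intersection; so the radical is a member of
        \<open>\<P>'\<close>.\<close>
      from primeideal_ideal_Inter[OF this, of \<P>']
      obtain P where "P \<in> \<P>'" "P \<subseteq> radical_ideal R Q"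
        using radeq fin idealP by (auto simp: \<P>'_def)
      moreover from this have "radical_ideal R Q \<subseteq> P"
        unfolding radeq ideal_Inter_def by blast
      ultimately have "radical_ideal R Q = P" "P \<in> \<P>" by (auto simp: \<P>'_def)
      then show ?thesis by simp
    qed
    \<comment> \<open>Take \<open>y\<close> in all other primes but not in the radical. Every
      \<open>z\<close> in the radical gives \<open>z \<otimes> y\<close> in the full intersection,
      hence in \<open>Q\<close>; no power of \<open>y\<close> is in \<open>Q\<close>, so primariness
      returns \<open>z\<close>.\<close>
    have "radical_ideal R Q = Q" if Q: "Q \<in> \<Q>" for Q
    proof
      show "Q \<subseteq> radical_ideal R Q" by (rule radical_ideal_superset[OF idealQ[OF Q]])
      obtain y where y: "y \<in> ideal_Inter R (\<P> - {radical_ideal R Q})" "y \<notin> radical_ideal R Q"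
        using irred[OF rad[OF Q]] by blast
      have yc: "y \<in> carrier R" using y by (simp add: ideal_Inter_def)
      show "radical_ideal R Q \<subseteq> Q"
      proof
        fix z assume z: "z \<in> radical_ideal R Q"
        then have zc: "z \<in> carrier R" by (simp add: radical_ideal_def)
        have "z \<otimes> y \<in> ideal_Inter R \<P>"
          using y z zc yc ideal.I_r_closed[OF idealP] ideal.I_l_closed[OF idealP]
          unfolding ideal_Inter_def by blast
        then have "z \<otimes> y \<in> Q" using Q unfolding eq by (auto simp: ideal_Inter_def)
        then show "z \<in> Q" using prim[OF Q] zc yc y(2) by (auto simp: primary_ideal_def)
      qed
    qed
    note radQ = this
    show "\<Q> = \<P>"
    proof
      show "\<Q> \<subseteq> \<P>" using rad radQ by auto
      \<comment> \<open>Each \<open>P\<close> contains the intersection of \<open>\<Q>\<close>,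
        hence some \<open>Q\<close>, which is already known to be a member of \<open>\<P>\<close>;
        incomparability makes them equal.\<close>
      show "\<P> \<subseteq> \<Q>"
      proof
        fix P assume P: "P \<in> \<P>"
        then have "ideal_Inter R \<Q> \<subseteq> P" unfolding eq[symmetric] by (auto simp: ideal_Inter_def)
        then obtain Q where Q: "Q \<in> \<Q>" "Q \<subseteq> P"
          using primeideal_ideal_Inter[OF prime[OF P] finQ idealQ] by blast
        then have "Q = P" using incomp[of Q P] rad[of Q] radQ[of Q] P by simp
        then show "P \<in> \<Q>" using Q by simp
      qed
    qed
  }
qed

section \<open>Primes of a quotient ring and primes above the ideal\<close>

lemma (in ring) a_rcos_image_mem_iff:
  assumes I: "ideal I R" and J: "ideal J R" and "I \<subseteq> J" and r: "r \<in> carrier R"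
  shows "I +> r \<in> (+>) I ` J \<longleftrightarrow> r \<in> J"
proof
  interpret I: ideal I R by fact
  interpret J: ideal J R by fact
  assume "I +> r \<in> (+>) I ` J"
  then obtain j where j: "j \<in> J" "I +> r = I +> j" by blast
  then have "r \<in> I +> j" using I.a_rcos_self r by blast
  then obtain i where "i \<in> I" "r = i \<oplus> j"
    by (auto simp: a_r_coset_def')
  then show "r \<in> J" using j assms(3) by blast
qed simp

lemma (in cring) primeideal_quot_image:
  assumes I: "ideal I R" and P: "primeideal P R" and IP: "I \<subseteq> P"
  shows "primeideal ((+>) I ` P) (R Quot I)"
proof -
  interpret I: ideal I R by fact
  interpret P: primeideal P R by fact
  have carr: "carrier (R Quot I) = (+>) I ` carrier R"
    by (auto simp: FactRing_def A_RCOSETS_def')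
  note mem = a_rcos_image_mem_iff[OF I P.is_ideal IP]
  show ?thesis
  proof (rule primeidealI)
    show "ideal ((+>) I ` P) (R Quot I)" by (rule ring_ideal_imp_quot_ideal[OF I P.is_ideal])
    show "cring (R Quot I)" by (rule I.quotient_is_cring[OF is_cring])
    have "I +> \<one> \<notin> (+>) I ` P"
      using mem[of \<one>] P.I_notcarr P.one_imp_carrier by auto
    then show "carrier (R Quot I) \<noteq> (+>) I ` P"
      unfolding carr by blast
    fix a b assume "a \<in> carrier (R Quot I)" "b \<in> carrier (R Quot I)"
      and ab: "a \<otimes>\<^bsub>R Quot I\<^esub> b \<in> (+>) I ` P"
    then obtain r s where rs: "r \<in> carrier R" "s \<in> carrier R" "a = I +> r" "b = I +> s"
      unfolding carr by blast
    then have "a \<otimes>\<^bsub>R Quot I\<^esub> b = I +> (r \<otimes> s)"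
      using ring_hom_mult[OF I.rcos_ring_hom] by simp
    then show "a \<in> (+>) I ` P \<or> b \<in> (+>) I ` P"
      using ab rs P.I_prime[of r s] mem by auto
  qed
qed

text \<open>Preimages and images under the quotient map exchange the two kinds of chains. Images
  stay strict because an ideal above \<open>I\<close> is a union of cosets of \<open>I\<close>, so
  membership can be tested on any representative. Later dimension arguments then never leave
  \<open>R\<close>.\<close>

lemma (in cring) krull_dim_quot:
  assumes I: "ideal I R"
  shows "krull_dim (R Quot I) =
    (SUP l \<in> {l. \<exists>P. (\<forall>k\<le>l. primeideal (P k) R \<and> I \<subseteq> P k) \<and> (\<forall>k<l. P k \<subset> P (Suc k))}. enat l)"
proof -
  interpret I: ideal I R by fact
  have carr: "carrier (R Quot I) = (+>) I ` carrier R"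
    by (auto simp: FactRing_def A_RCOSETS_def')
  have "(\<exists>P. (\<forall>k\<le>l. primeideal (P k) (R Quot I)) \<and> (\<forall>k<l. P k \<subset> P (Suc k))) \<longleftrightarrow>
    (\<exists>P. (\<forall>k\<le>l. primeideal (P k) R \<and> I \<subseteq> P k) \<and> (\<forall>k<l. P k \<subset> P (Suc k)))"
    (is "?L \<longleftrightarrow> ?R") for l
  proof
    assume ?L
    then obtain P where P: "\<And>k. k \<le> l \<Longrightarrow> primeideal (P k) (R Quot I)"
      "\<And>k. k < l \<Longrightarrow> P k \<subset> P (Suc k)" by blast
    define P' where "P' k = {r \<in> carrier R. I +> r \<in> P k}" for k
    have "primeideal (P' k) R \<and> I \<subseteq> P' k" if k: "k \<le> l" for k
    proof
      interpret Pk: primeideal "P k" "R Quot I" using P(1)[OF k] .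
      show "primeideal (P' k) R" unfolding P'_def
        by (rule ring_hom_ring.primeideal_vimage[OF I.rcos_ring_hom_ring is_cring P(1)[OF k]])
      have "\<zero>\<^bsub>R Quot I\<^esub> \<in> P k" by (rule additive_subgroup.zero_closed[OF ideal.axioms(1)[OF Pk.is_ideal]])
      then have "I \<in> P k" unfolding FactRing_def by simp
      then show "I \<subseteq> P' k" by (auto simp: P'_def I.a_rcos_const I.Icarr)
    qed
    moreover have "P' k \<subset> P' (Suc k)" if k: "k < l" for k
    proof -
      interpret Pk: primeideal "P (Suc k)" "R Quot I" using P(1)[of "Suc k"] k by simp
      obtain X where X: "X \<in> P (Suc k)" "X \<notin> P k" using P(2)[OF k] by blast
      then obtain r where "r \<in> carrier R" "X = I +> r" using Pk.Icarr carr by blast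
      then show ?thesis using X P(2)[OF k] by (auto simp: P'_def)
    qed
    ultimately show ?R by blast
  next
    assume ?R
    then obtain P where P: "\<And>k. k \<le> l \<Longrightarrow> primeideal (P k) R" "\<And>k. k \<le> l \<Longrightarrow> I \<subseteq> P k"
      "\<And>k. k < l \<Longrightarrow> P k \<subset> P (Suc k)" by blast
    have "(+>) I ` P k \<subset> (+>) I ` P (Suc k)" if k: "k < l" for k
    proof -
      interpret Pk: primeideal "P k" R using P(1) k by simp
      interpret Sk: primeideal "P (Suc k)" R using P(1)[of "Suc k"] k by simp
      obtain r where r: "r \<in> P (Suc k)" "r \<notin> P k" using P(3)[OF k] by blast
      then have "I +> r \<notin> (+>) I ` P k"
        using a_rcos_image_mem_iff[OF I Pk.is_ideal P(2), of r] k Sk.Icarr by simp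
      then show ?thesis using P(3)[OF k] r(1) by blast
    qed
    then show ?L using P primeideal_quot_image[OF I]
      by (intro exI[of _ "\<lambda>k. (+>) I ` P k"]) auto
  qed
  then show ?thesis unfolding krull_dim_def by simp
qed

section \<open>Ideals spanned by monomials\<close>

lemma poly_ring_simps:
  "x \<otimes>\<^bsub>poly_ring n\<^esub> y = x * y" "x \<oplus>\<^bsub>poly_ring n\<^esub> y = x + y"
  "\<one>\<^bsub>poly_ring n\<^esub> = 1" "\<zero>\<^bsub>poly_ring n\<^esub> = 0"
  by (simp_all add: poly_ring_def)

lemma mem_carrier_poly_ring:
  "p \<in> carrier (poly_ring n) \<longleftrightarrow> (\<forall>m\<in>Poly_Mapping.keys p. Poly_Mapping.keys m \<subseteq> {1..n})"
  by (simp add: poly_ring_def)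

lemma a_inv_poly_ring:
  fixes p :: "'k::field mpoly"
  assumes "p \<in> carrier (poly_ring n)"
  shows "\<ominus>\<^bsub>poly_ring n\<^esub> p = - p"
proof -
  interpret cring "poly_ring n :: 'k mpoly ring" by (rule cring_poly_ring)
  show ?thesis
    by (rule minus_equality) (use assms in \<open>auto simp: poly_ring_simps mem_carrier_poly_ring\<close>)
qed

lemma keys_add_nat:
  fixes a b :: "'a \<Rightarrow>\<^sub>0 nat"
  shows "Poly_Mapping.keys (a + b) = Poly_Mapping.keys a \<union> Poly_Mapping.keys b"
  by (auto simp: in_keys_iff lookup_add)

lemma keys_times_subsetD:
  fixes p q :: "'k::field mpoly"
  assumes "m \<in> Poly_Mapping.keys (p * q)"
  obtains a b where "a \<in> Poly_Mapping.keys p" "b \<in> Poly_Mapping.keys q" "m = a + b"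
  using keys_mult[of p q] assms by blast

text \<open>This is how polynomials are reduced modulo a monomial ideal: \<open>A\<close> holds the
  exponents outside the ideal, and \<open>r\<close> is the part that lies in it.\<close>

lemma poly_mapping_split:
  fixes p :: "'a \<Rightarrow>\<^sub>0 'b::monoid_add"
  obtains q r where "p = q + r" "Poly_Mapping.keys q = Poly_Mapping.keys p \<inter> A"
    "Poly_Mapping.keys r = Poly_Mapping.keys p - A"
proof
  let ?q = "Poly_Mapping.mapp (\<lambda>m c. c when m \<in> A) p"
  let ?r = "Poly_Mapping.mapp (\<lambda>m c. c when m \<notin> A) p"
  show "p = ?q + ?r"
    by (rule poly_mapping_eqI) (auto simp: lookup_add lookup_mapp when_def in_keys_iff)
  show "Poly_Mapping.keys ?q = Poly_Mapping.keys p \<inter> A"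
    "Poly_Mapping.keys ?r = Poly_Mapping.keys p - A"
    by (auto simp: in_keys_iff lookup_mapp when_def split: if_splits)
qed

lemma poly_mapping_sum_single:
  fixes p :: "'a \<Rightarrow>\<^sub>0 'b::comm_monoid_add"
  shows "p = (\<Sum>m\<in>Poly_Mapping.keys p. Poly_Mapping.single m (Poly_Mapping.lookup p m))"
  by (rule poly_mapping_eqI)
    (auto simp: lookup_sum lookup_single when_def in_keys_iff)

text \<open>One notion covers all the ideals needed: \<open>S = {F}\<close> gives the prime
  \<open>P\<^sub>F\<close>, a complex gives its Stanley-Reisner ideal, part of a complex gives a
  stage of the filtration, and \<open>S = {}\<close> gives the whole ring.\<close>

definition mono_ideal :: "nat \<Rightarrow> nat set set \<Rightarrow> 'k::field mpoly set" where
  "mono_ideal n S = {p \<in> carrier (poly_ring n).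
     \<forall>m\<in>Poly_Mapping.keys p. \<forall>F\<in>S. \<not> Poly_Mapping.keys m \<subseteq> F}"

text \<open>Only the downward closure of \<open>S\<close> matters, so facets and faces can be traded
  for each other.\<close>

lemma mono_ideal_cong:
  assumes "\<And>\<sigma>. (\<exists>F\<in>S. \<sigma> \<subseteq> F) \<longleftrightarrow> (\<exists>F\<in>T. \<sigma> \<subseteq> F)"
  shows "mono_ideal n S = mono_ideal n T"
  using assms unfolding mono_ideal_def by blast

text \<open>Multiplication by a monomial only enlarges supports, so a support contained in no member
  of \<open>S\<close> remains so.\<close>

lemma ideal_mono_ideal: "ideal (mono_ideal n S :: 'k::field mpoly set) (poly_ring n)"
proof -
  interpret cring "poly_ring n :: 'k mpoly ring" by (rule cring_poly_ring)
  have add: "x + y \<in> mono_ideal n S" if "x \<in> mono_ideal n S" "y \<in> mono_ideal n S" for x y :: "'k mpoly"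
    using that by (auto simp: mono_ideal_def mem_carrier_poly_ring dest!: subsetD[OF Poly_Mapping.keys_add])
  have mult: "x * y \<in> mono_ideal n S" if x: "x \<in> carrier (poly_ring n)" and y: "y \<in> mono_ideal n S"
    for x y :: "'k mpoly"
  proof -
    have "x * y \<in> carrier (poly_ring n)"
      using m_closed[of x y] x y by (simp add: mono_ideal_def poly_ring_simps)
    moreover have "\<not> Poly_Mapping.keys m \<subseteq> F" if m: "m \<in> Poly_Mapping.keys (x * y)" and "F \<in> S" for m F
    proof -
      obtain a b where "b \<in> Poly_Mapping.keys y" "m = a + b" using m by (rule keys_times_subsetD)
      then show ?thesis using y \<open>F \<in> S\<close> by (auto simp: mono_ideal_def keys_add_nat)
    qed
    ultimately show ?thesis by (auto simp: mono_ideal_def)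
  qed
  have sub: "mono_ideal n S \<subseteq> carrier (poly_ring n :: 'k mpoly ring)"
    by (auto simp: mono_ideal_def)
  show ?thesis
  proof (rule idealI)
    show "ring (poly_ring n :: 'k mpoly ring)" by (rule ring_axioms)
    show "subgroup (mono_ideal n S :: 'k mpoly set) (add_monoid (poly_ring n))"
    proof (rule add.subgroupI)
      show "(mono_ideal n S :: 'k mpoly set) \<subseteq> carrier (poly_ring n)" by (rule sub)
      have "0 \<in> (mono_ideal n S :: 'k mpoly set)" by (simp add: mono_ideal_def mem_carrier_poly_ring)
      then show "(mono_ideal n S :: 'k mpoly set) \<noteq> {}" by blast
      show "\<ominus>\<^bsub>poly_ring n\<^esub> x \<in> mono_ideal n S" if x: "x \<in> mono_ideal n S" for x :: "'k mpoly"
      proof -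
        have "- x \<in> mono_ideal n S" using x by (simp add: mono_ideal_def mem_carrier_poly_ring)
        then show ?thesis using a_inv_poly_ring[OF subsetD[OF sub x]] by simp
      qed
      show "x \<oplus>\<^bsub>poly_ring n\<^esub> y \<in> mono_ideal n S"
        if "x \<in> mono_ideal n S" "y \<in> mono_ideal n S" for x y :: "'k mpoly"
        unfolding poly_ring_simps by (rule add[OF that])
    qed
    fix a x :: "'k mpoly" assume "a \<in> mono_ideal n S" "x \<in> carrier (poly_ring n)"
    then show "x \<otimes>\<^bsub>poly_ring n\<^esub> a \<in> mono_ideal n S" "a \<otimes>\<^bsub>poly_ring n\<^esub> x \<in> mono_ideal n S"
      using mult[of x a] by (simp_all add: poly_ring_simps mult.commute[of a x])
  qed
qed

lemma ideal_Inter_mono_ideal: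
  "ideal_Inter (poly_ring n) ((\<lambda>F. mono_ideal n {F}) ` S) = mono_ideal n S"
  by (auto simp: ideal_Inter_def mono_ideal_def)

lemma one_mem_mono_ideal_iff: "1 \<in> mono_ideal n S \<longleftrightarrow> S = {}"
  by (auto simp: mono_ideal_def mem_carrier_poly_ring)

text \<open>Modulo \<open>mono_ideal n {F}\<close> every polynomial is congruent to its part supported on \<open>F\<close>, and
  polynomials supported on \<open>F\<close> have no zero divisors.\<close>

lemma primeideal_mono_ideal:
  "primeideal (mono_ideal n {F} :: 'k::field mpoly set) (poly_ring n)"
proof (rule primeidealI[OF ideal_mono_ideal cring_poly_ring])
  interpret cring "poly_ring n :: 'k mpoly ring" by (rule cring_poly_ring)
  interpret I: ideal "mono_ideal n {F} :: 'k mpoly set" "poly_ring n" by (rule ideal_mono_ideal)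
  show "carrier (poly_ring n) \<noteq> (mono_ideal n {F} :: 'k mpoly set)"
    using one_mem_mono_ideal_iff[of n "{F}"] one_closed by (auto simp: poly_ring_simps)
  fix a b :: "'k mpoly"
  assume a: "a \<in> carrier (poly_ring n)" and b: "b \<in> carrier (poly_ring n)"
    and ab: "a \<otimes>\<^bsub>poly_ring n\<^esub> b \<in> mono_ideal n {F}"
  let ?A = "{m. Poly_Mapping.keys m \<subseteq> F}"
  obtain a1 a2 where a12: "a = a1 + a2" "Poly_Mapping.keys a1 = Poly_Mapping.keys a \<inter> ?A"
    "Poly_Mapping.keys a2 = Poly_Mapping.keys a - ?A" by (rule poly_mapping_split)
  obtain b1 b2 where b12: "b = b1 + b2" "Poly_Mapping.keys b1 = Poly_Mapping.keys b \<inter> ?A"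
    "Poly_Mapping.keys b2 = Poly_Mapping.keys b - ?A" by (rule poly_mapping_split)
  have carr: "a1 \<in> carrier (poly_ring n)" "b1 \<in> carrier (poly_ring n)"
    using a b a12 b12 by (auto simp: mem_carrier_poly_ring)
  have a2: "a2 \<in> mono_ideal n {F}" and b2: "b2 \<in> mono_ideal n {F}"
    using a b a12 b12 by (auto simp: mem_carrier_poly_ring mono_ideal_def)
  have "a2 * b \<in> mono_ideal n {F}" "a1 * b2 \<in> mono_ideal n {F}"
    using I.I_r_closed[OF a2 b] I.I_l_closed[OF b2 carr(1)] by (simp_all add: poly_ring_simps)
  moreover have "a1 * b1 = a * b - (a2 * b + a1 * b2)"
    unfolding a12(1) b12(1) by (simp add: algebra_simps)
  moreover have "x - y \<in> mono_ideal n {F}" if "x \<in> mono_ideal n {F}" "y \<in> mono_ideal n {F}"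
    for x y :: "'k mpoly"
    using that by (auto simp: mono_ideal_def mem_carrier_poly_ring dest!: subsetD[OF Poly_Mapping.keys_diff])
  moreover have "x + y \<in> mono_ideal n {F}" if "x \<in> mono_ideal n {F}" "y \<in> mono_ideal n {F}"
    for x y :: "'k mpoly"
    using I.a_closed[OF that] by (simp add: poly_ring_simps)
  ultimately have "a1 * b1 \<in> mono_ideal n {F}"
    using ab by (simp add: poly_ring_simps)
  moreover have "Poly_Mapping.keys m \<subseteq> F" if m: "m \<in> Poly_Mapping.keys (a1 * b1)" for m
    using m by (rule keys_times_subsetD) (use a12(2) b12(2) in \<open>auto simp: keys_add_nat\<close>)
  ultimately have "Poly_Mapping.keys (a1 * b1) = {}"
    unfolding mono_ideal_def by blast
  then have "a1 = 0 \<or> b1 = 0" by simp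
  then show "a \<in> mono_ideal n {F} \<or> b \<in> mono_ideal n {F}"
    using a12(1) b12(1) a2 b2 by auto
qed

definition set_monomial :: "nat set \<Rightarrow> (nat \<Rightarrow>\<^sub>0 nat)" where
  "set_monomial G = (\<Sum>i\<in>G. Poly_Mapping.single i 1)"

lemma lookup_set_monomial:
  "finite G \<Longrightarrow> Poly_Mapping.lookup (set_monomial G) i = (if i \<in> G then 1 else 0)"
  by (simp add: set_monomial_def lookup_sum lookup_single when_def)

lemma keys_set_monomial: "finite G \<Longrightarrow> Poly_Mapping.keys (set_monomial G) = G"
  by (auto simp: in_keys_iff lookup_set_monomial split: if_splits)

lemma prod_mvar:
  "finite G \<Longrightarrow> (\<Prod>i\<in>G. mvar i) = (Poly_Mapping.single (set_monomial G) 1 :: 'k::field mpoly)"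
  by (induction G rule: finite_induct) (simp_all add: set_monomial_def mvar_def mult_single)

text \<open>The squarefree monomial with support \<open>F'\<close> is the witness: it avoids the
  right-hand ideal, and the left-hand one only if \<open>F' \<subseteq> F\<close>. The bound on
  \<open>F'\<close> places it in the ring.\<close>

lemma mono_ideal_subset_iff:
  assumes "F' \<subseteq> {1..n}"
  shows "(mono_ideal n {F} :: 'k::field mpoly set) \<subseteq> mono_ideal n {F'} \<longleftrightarrow> F' \<subseteq> F"
proof
  assume sub: "(mono_ideal n {F} :: 'k mpoly set) \<subseteq> mono_ideal n {F'}"
  have fin: "finite F'" using assms finite_subset by blast
  have "(Poly_Mapping.single (set_monomial F') 1 :: 'k mpoly) \<notin> mono_ideal n {F'}"
    by (simp add: mono_ideal_def keys_set_monomial[OF fin])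
  then have "(Poly_Mapping.single (set_monomial F') 1 :: 'k mpoly) \<notin> mono_ideal n {F}"
    using sub by blast
  then show "F' \<subseteq> F"
    using assms by (auto simp: mono_ideal_def mem_carrier_poly_ring keys_set_monomial[OF fin])
qed (auto simp: mono_ideal_def)

text \<open>A monomial whose support is a nonface is divisible by the generator belonging to its own
  support. Conversely, downward closure keeps a nonface from lying inside a face.\<close>

lemma stanley_reisner_ideal_eq:
  assumes \<Delta>: "simplicial_complex n \<Delta>"
  shows "(stanley_reisner_ideal n \<Delta> :: 'k::field mpoly set) = mono_ideal n \<Delta>"
proof
  interpret cring "poly_ring n :: 'k mpoly ring" by (rule cring_poly_ring)
  let ?gens = "{\<Prod>i\<in>G. mvar i | G. G \<subseteq> {1..n} \<and> G \<notin> \<Delta>} :: 'k mpoly set"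
  have fin: "finite G" if "G \<subseteq> {1..n}" for G :: "nat set" using that finite_subset by blast
  have down: "G \<in> \<Delta>" if "F \<in> \<Delta>" "G \<subseteq> F" for F G
    using \<Delta> that by (auto simp: simplicial_complex_def)
  have gens: "?gens \<subseteq> mono_ideal n \<Delta>"
  proof clarify
    fix G :: "nat set" assume G: "G \<subseteq> {1..n}" "G \<notin> \<Delta>"
    then have "\<not> G \<subseteq> F" if "F \<in> \<Delta>" for F using down that by blast
    then show "(\<Prod>i\<in>G. mvar i) \<in> (mono_ideal n \<Delta> :: 'k mpoly set)"
      using G(1) by (simp add: prod_mvar fin mono_ideal_def mem_carrier_poly_ring keys_set_monomial)
  qed
  show "(stanley_reisner_ideal n \<Delta> :: 'k mpoly set) \<subseteq> mono_ideal n \<Delta>"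
    unfolding stanley_reisner_ideal_def by (rule genideal_minimal[OF ideal_mono_ideal gens])
  have genscarr: "?gens \<subseteq> carrier (poly_ring n)" using gens by (auto simp: mono_ideal_def)
  interpret I: ideal "stanley_reisner_ideal n \<Delta> :: 'k mpoly set" "poly_ring n"
    unfolding stanley_reisner_ideal_def by (rule genideal_ideal[OF genscarr])
  have mono: "Poly_Mapping.single m c \<in> (stanley_reisner_ideal n \<Delta> :: 'k mpoly set)"
    if m: "Poly_Mapping.keys m \<subseteq> {1..n}" "Poly_Mapping.keys m \<notin> \<Delta>" for m and c :: 'k
  proof -
    let ?e = "set_monomial (Poly_Mapping.keys m)"
    have "m = (m - ?e) + ?e"
      by (rule poly_mapping_eqI) (auto simp: lookup_add lookup_minus lookup_set_monomial in_keys_iff)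
    then have "Poly_Mapping.single m c = Poly_Mapping.single (m - ?e) c * Poly_Mapping.single ?e 1"
      by (simp add: mult_single)
    moreover have "(\<Prod>i\<in>Poly_Mapping.keys m. mvar i) \<in> ?gens" using m by blast
    then have e: "Poly_Mapping.single ?e 1 \<in> (stanley_reisner_ideal n \<Delta> :: 'k mpoly set)"
      unfolding stanley_reisner_ideal_def prod_mvar[OF finite_keys]
      using genideal_self[OF genscarr] by (rule subsetD[rotated])
    moreover have "Poly_Mapping.keys (m - ?e) \<subseteq> Poly_Mapping.keys m"
      by (auto simp: in_keys_iff lookup_minus)
    then have "(Poly_Mapping.single (m - ?e) c :: 'k mpoly) \<in> carrier (poly_ring n)"
      using m(1) by (auto simp: mem_carrier_poly_ring)
    from I.I_l_closed[OF e this]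
    have "Poly_Mapping.single (m - ?e) c * Poly_Mapping.single ?e 1
        \<in> (stanley_reisner_ideal n \<Delta> :: 'k mpoly set)"
      unfolding poly_ring_simps .
    ultimately show ?thesis by (simp only:)
  qed
  have sums: "(\<Sum>m\<in>A. f m) \<in> (stanley_reisner_ideal n \<Delta> :: 'k mpoly set)"
    if "finite A" "\<And>m. m \<in> A \<Longrightarrow> f m \<in> stanley_reisner_ideal n \<Delta>" for A and f :: "(nat \<Rightarrow>\<^sub>0 nat) \<Rightarrow> 'k mpoly"
    using that
  proof (induction A rule: finite_induct)
    case empty
    have "\<zero>\<^bsub>poly_ring n\<^esub> \<in> (stanley_reisner_ideal n \<Delta> :: 'k mpoly set)"
      by (rule additive_subgroup.zero_closed[OF I.additive_subgroup_axioms])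
    then show ?case by (simp add: poly_ring_simps)
  next
    case (insert m A)
    then show ?case
      using I.a_closed[of "f m" "sum f A"] by (simp add: poly_ring_simps)
  qed
  show "mono_ideal n \<Delta> \<subseteq> (stanley_reisner_ideal n \<Delta> :: 'k mpoly set)"
  proof
    fix p :: "'k mpoly" assume p: "p \<in> mono_ideal n \<Delta>"
    show "p \<in> stanley_reisner_ideal n \<Delta>"
      by (subst poly_mapping_sum_single, rule sums, simp, rule mono)
        (use p in \<open>auto simp: mono_ideal_def mem_carrier_poly_ring\<close>)
  qed
qed

section \<open>Constants as scalars, and ideals of \<open>poly_ring n\<close> in terms of the
  polynomial operations\<close>

lemma mconst_simps:
  "mconst (a + b) = mconst a + mconst b" "mconst (a * b) = mconst a * mconst b"
  "mconst 0 = 0" "mconst 1 = 1" "mconst (- a) = - mconst a"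
  by (simp_all add: mconst_def single_add mult_single single_uminus)

lemma mconst_mult_single: "mconst c * Poly_Mapping.single m d = Poly_Mapping.single m (c * d)"
  by (simp add: mconst_def mult_single)

lemma mconst_closed: "mconst c \<in> carrier (poly_ring n)"
  by (simp add: mconst_def mem_carrier_poly_ring)

text \<open>Supplies the comparison of an independent set with a finite spanning set in the bound on
  chains of primes.\<close>

lemma vector_space_mpoly: "vector_space (\<lambda>(c :: 'k::field) (p :: 'k mpoly). mconst c * p)"
  by unfold_locales (simp_all add: mconst_simps algebra_simps)

lemma poly_ring_closed:
  fixes x y :: "'k::field mpoly"
  shows "0 \<in> carrier (poly_ring n :: 'k mpoly ring)" "1 \<in> carrier (poly_ring n :: 'k mpoly ring)"
    "\<lbrakk>x \<in> carrier (poly_ring n); y \<in> carrier (poly_ring n)\<rbrakk> \<Longrightarrow> x + y \<in> carrier (poly_ring n)"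
    "\<lbrakk>x \<in> carrier (poly_ring n); y \<in> carrier (poly_ring n)\<rbrakk> \<Longrightarrow> x * y \<in> carrier (poly_ring n)"
proof -
  interpret cring "poly_ring n :: 'k mpoly ring" by (rule cring_poly_ring)
  show "0 \<in> carrier (poly_ring n :: 'k mpoly ring)" "1 \<in> carrier (poly_ring n :: 'k mpoly ring)"
    using zero_closed one_closed unfolding poly_ring_simps .
  show "\<lbrakk>x \<in> carrier (poly_ring n); y \<in> carrier (poly_ring n)\<rbrakk> \<Longrightarrow> x + y \<in> carrier (poly_ring n)"
    "\<lbrakk>x \<in> carrier (poly_ring n); y \<in> carrier (poly_ring n)\<rbrakk> \<Longrightarrow> x * y \<in> carrier (poly_ring n)"
    using a_closed[of x y] m_closed[of x y] unfolding poly_ring_simps by blast+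
qed

lemma poly_ring_power_closed:
  fixes x :: "'k::field mpoly"
  shows "x \<in> carrier (poly_ring n) \<Longrightarrow> x ^ m \<in> carrier (poly_ring n)"
  by (induction m) (simp_all add: poly_ring_closed)

lemma poly_ring_ideal_closed:
  fixes x y :: "'k::field mpoly"
  assumes "ideal I (poly_ring n)"
  shows "0 \<in> I" "\<lbrakk>x \<in> I; y \<in> I\<rbrakk> \<Longrightarrow> x + y \<in> I" "x \<in> I \<Longrightarrow> x \<in> carrier (poly_ring n)"
    "\<lbrakk>x \<in> carrier (poly_ring n); y \<in> I\<rbrakk> \<Longrightarrow> x * y \<in> I"
    "\<lbrakk>x \<in> I; y \<in> I\<rbrakk> \<Longrightarrow> x - y \<in> I"
proof -
  interpret ideal I "poly_ring n" by fact
  show "0 \<in> I" using additive_subgroup.zero_closed[OF additive_subgroup_axioms]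
    unfolding poly_ring_simps .
  show add: "x + y \<in> I" if "x \<in> I" "y \<in> I" for x y
    using additive_subgroup.a_closed[OF additive_subgroup_axioms that] unfolding poly_ring_simps .
  show "x \<in> I \<Longrightarrow> x \<in> carrier (poly_ring n)" by (rule Icarr)
  show mult: "x * y \<in> I" if "x \<in> carrier (poly_ring n)" "y \<in> I" for x y
    using I_l_closed[OF that(2,1)] unfolding poly_ring_simps .
  show "x - y \<in> I" if "x \<in> I" "y \<in> I"
    using add[OF that(1) mult[OF mconst_closed that(2), of "- 1"]] by (simp add: mconst_simps)
qed

lemma poly_ring_ideal_sum_closed:
  fixes f :: "'b \<Rightarrow> 'k::field mpoly"
  assumes "ideal I (poly_ring n)" and "\<And>a. a \<in> A \<Longrightarrow> f a \<in> I"
  shows "sum f A \<in> I"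
  using assms(2) by (induction A rule: infinite_finite_induct) (simp_all add: poly_ring_ideal_closed[OF assms(1)])

lemma poly_ring_primeideal:
  fixes x y :: "'k::field mpoly"
  assumes "primeideal P (poly_ring n)"
  shows "\<lbrakk>x \<in> carrier (poly_ring n); y \<in> carrier (poly_ring n); x * y \<in> P\<rbrakk> \<Longrightarrow> x \<in> P \<or> y \<in> P"
    and "1 \<notin> P"
proof -
  interpret primeideal P "poly_ring n" by fact
  show "\<lbrakk>x \<in> carrier (poly_ring n); y \<in> carrier (poly_ring n); x * y \<in> P\<rbrakk> \<Longrightarrow> x \<in> P \<or> y \<in> P"
    using I_prime[of x y] unfolding poly_ring_simps .
  show "1 \<notin> P" using one_imp_carrier I_notcarr unfolding poly_ring_simps by metis
qed

lemma poly_ring_primeideal_power: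
  fixes x :: "'k::field mpoly"
  assumes P: "primeideal P (poly_ring n)" and x: "x \<in> carrier (poly_ring n)"
  shows "x ^ m \<in> P \<Longrightarrow> x \<in> P"
proof (induction m)
  case 0
  then show ?case using poly_ring_primeideal(2)[OF P] by simp
next
  case (Suc m)
  then show ?case using poly_ring_primeideal(1)[OF P x poly_ring_power_closed[OF x], of m] by auto
qed

section \<open>Chains of primes in the polynomial ring\<close>

text \<open>The recursion shifts \<open>f\<close>, so that removing the head exponent matches
  removing the first prime of a chain.\<close>

fun power_product :: "(nat \<Rightarrow> 'a::comm_monoid_mult) \<Rightarrow> nat list \<Rightarrow> 'a" where
  "power_product f [] = 1"
| "power_product f (a # as) = f 0 ^ a * power_product (\<lambda>k. f (Suc k)) as"

lemma power_product_closed: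
  fixes f :: "nat \<Rightarrow> 'k::field mpoly"
  assumes "\<And>k. k < length as \<Longrightarrow> f k \<in> carrier (poly_ring n)"
  shows "power_product f as \<in> carrier (poly_ring n)"
  using assms by (induction as arbitrary: f) (force simp: poly_ring_closed intro!: poly_ring_closed(4) poly_ring_power_closed)+

text \<open>Divide a relation by the largest power of \<open>f 0\<close> and reduce it modulo \<open>P 1\<close>: since \<open>f 0\<close>
  lies in \<open>P 1\<close> but not in \<open>P 0\<close>, a relation between \<open>f 1, \<dots>\<close> modulo \<open>P 1\<close> is left.\<close>

lemma prime_chain_independent:
  fixes f :: "nat \<Rightarrow> 'k::field mpoly"
  assumes "\<And>k. k \<le> l \<Longrightarrow> primeideal (P k) (poly_ring n)"
    and "\<And>k. k < l \<Longrightarrow> P k \<subseteq> P (Suc k)"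
    and "\<And>k. k < l \<Longrightarrow> f k \<in> P (Suc k)" and "\<And>k. k < l \<Longrightarrow> f k \<notin> P k"
    and "finite A" and "\<And>as. as \<in> A \<Longrightarrow> length as = l"
    and "(\<Sum>as\<in>A. mconst (c as) * power_product f as) \<in> P 0"
  shows "\<forall>as\<in>A. c as = 0"
  using assms
proof (induction l arbitrary: P f A c)
  case 0
  show ?case
  proof (rule ballI, rule ccontr)
    fix as assume as: "as \<in> A" "c as \<noteq> 0"
    \<comment> \<open>The empty list is the only exponent list of length 0, so the relation is a
      nonzero constant in \<open>P 0\<close>.\<close>
    then have "A = {[]}" "as = []" using 0(6) by auto
    then have "mconst (c []) \<in> P 0" using 0(7) by simp
    then have "mconst (inverse (c [])) * mconst (c []) \<in> P 0"
      using poly_ring_ideal_closed(4)[OF primeideal.axioms(1)[OF 0(1)[of 0]] mconst_closed] by simp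
    then have "1 \<in> P 0" using as \<open>as = []\<close> by (simp flip: mconst_simps)
    then show False using poly_ring_primeideal(2)[OF 0(1)[of 0]] by simp
  qed
next
  case (Suc l)
  have P0: "primeideal (P 0) (poly_ring n)" and P1: "primeideal (P 1) (poly_ring n)"
    using Suc.prems(1)[of 0] Suc.prems(1)[of 1] by simp_all
  have P01: "P 0 \<subseteq> P 1" and f01: "f 0 \<in> P 1" and f00: "f 0 \<notin> P 0"
    using Suc.prems(2,3,4)[of 0] by simp_all
  note id0 = poly_ring_ideal_closed[OF primeideal.axioms(1)[OF P0]]
  note id1 = poly_ring_ideal_closed[OF primeideal.axioms(1)[OF P1]]
  have fc: "f k \<in> carrier (poly_ring n)" if "k < Suc l" for k
    using poly_ring_ideal_closed(3)[OF primeideal.axioms(1)[OF Suc.prems(1)[of "Suc k"]] Suc.prems(3)] that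
    by simp
  define f' where "f' k = f (Suc k)" for k
  \<comment> \<open>Zero coefficients are discarded, so the minimal exponent \<open>s\<close> below
    is attained by a term that really occurs; this yields the final contradiction.\<close>
  define A' where "A' = {as \<in> A. c as \<noteq> 0}"
  have finA': "finite A'" using Suc.prems(5) by (simp add: A'_def)
  have cons: "as = hd as # tl as" "length (tl as) = l" if "as \<in> A'" for as
    using Suc.prems(6)[of as] that by (cases as; simp add: A'_def)+
  have ppc: "power_product f' (tl as) \<in> carrier (poly_ring n)" if "as \<in> A'" for as
    by (rule power_product_closed) (use cons[OF that] fc in \<open>simp add: f'_def\<close>)
  have "A' = {}"
  proof (rule ccontr)
    assume ne: "A' \<noteq> {}"
    define s where "s = Min (hd ` A')"
    have s_le: "s \<le> hd as" if "as \<in> A'" for as using finA' that by (simp add: s_def)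
    define B where "B = {as \<in> A'. hd as = s}"
    have "s \<in> hd ` A'" unfolding s_def using finA' ne by (intro Min_in) auto
    then have Bne: "B \<noteq> {}" by (auto simp: B_def)
    define q where "q as = f 0 ^ (hd as - s) * (mconst (c as) * power_product f' (tl as))" for as
    have pp: "power_product f as = f 0 ^ s * (f 0 ^ (hd as - s) * power_product f' (tl as))"
      if "as \<in> A'" for as
    proof -
      have "power_product f (hd as # tl as) = f 0 ^ (s + (hd as - s)) * power_product f' (tl as)"
        using s_le[OF that] by (simp add: f'_def[abs_def])
      then show ?thesis using cons(1)[OF that] by (simp add: power_add mult.assoc)
    qed
    have qc: "q as \<in> carrier (poly_ring n)" if "as \<in> A'" for as
      unfolding q_def by (intro poly_ring_closed poly_ring_power_closed fc mconst_closed ppc that) simp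
    have "(\<Sum>as\<in>A. mconst (c as) * power_product f as) = (\<Sum>as\<in>A'. mconst (c as) * power_product f as)"
      by (rule sum.mono_neutral_right) (use Suc.prems(5) in \<open>auto simp: A'_def mconst_simps\<close>)
    also have "\<dots> = f 0 ^ s * sum q A'"
      unfolding sum_distrib_left by (rule sum.cong) (simp_all add: pp q_def mult_ac)
    finally have "f 0 ^ s * sum q A' \<in> P 0" using Suc.prems(7) by simp
    moreover have "sum q A' \<in> carrier (poly_ring n)"
      by (rule poly_ring_ideal_sum_closed[OF ring.oneideal]) (use qc cring_poly_ring in \<open>auto simp: cring_def\<close>)
    moreover have "f 0 ^ s \<notin> P 0" using poly_ring_primeideal_power[OF P0 fc, of 0 s] f00 by auto
    ultimately have "sum q A' \<in> P 0"
      using poly_ring_primeideal(1)[OF P0 poly_ring_power_closed[OF fc], of 0 "sum q A'" s] by auto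
    then have "sum q A' \<in> P 1" using P01 by blast
    moreover have "sum q (A' - B) \<in> P 1"
    proof (rule poly_ring_ideal_sum_closed[OF primeideal.axioms(1)[OF P1]])
      fix as assume as: "as \<in> A' - B"
      then have "s < hd as" using s_le[of as] by (auto simp: B_def)
      then obtain d where d: "hd as - s = Suc d" by (metis Suc_diff_Suc)
      have "q as = (f 0 ^ d * (mconst (c as) * power_product f' (tl as))) * f 0"
        unfolding q_def d by (simp add: mult_ac)
      also have "\<dots> \<in> P 1"
        by (intro id1(4) f01 poly_ring_closed poly_ring_power_closed fc mconst_closed ppc)
          (use as in auto)
      finally show "q as \<in> P 1" .
    qed
    moreover have "sum q B = sum q A' - sum q (A' - B)"
      using sum.subset_diff[of B A' q] finA' by (simp add: B_def)
    ultimately have "sum q B \<in> P 1" using id1(5) by simp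
    also have "sum q B = (\<Sum>as\<in>B. mconst (c (s # tl as)) * power_product f' (tl as))"
    proof (rule sum.cong)
      fix as assume "as \<in> B"
      then have "hd as = s" "as = s # tl as" using cons(1)[of as] by (auto simp: B_def)
      then show "q as = mconst (c (s # tl as)) * power_product f' (tl as)" by (simp add: q_def)
    qed simp
    \<comment> \<open>All lists in \<open>B\<close> share the head \<open>s\<close> and are
      determined by their tails; reindexing by tails gives a relation with exponent lists of length
      \<open>l\<close>.\<close>
    also have "\<dots> = (\<Sum>bs\<in>tl ` B. mconst (c (s # bs)) * power_product f' bs)"
    proof -
      have "inj_on tl B"
        using cons(1) by (intro inj_onI) (metis (mono_tags, lifting) B_def mem_Collect_eq)
      then show ?thesis by (simp add: sum.reindex)
    qed
    finally have rel: "(\<Sum>bs\<in>tl ` B. mconst (c (s # bs)) * power_product f' bs) \<in> P 1" .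
    have "\<forall>bs\<in>tl ` B. c (s # bs) = 0"
    proof (rule Suc.IH[of "\<lambda>k. P (Suc k)" f'])
      show "finite (tl ` B)" using finA' by (simp add: B_def)
      show "length bs = l" if "bs \<in> tl ` B" for bs using that cons(2) by (auto simp: B_def)
    qed (use Suc.prems(1-4) rel in \<open>simp_all add: f'_def[abs_def]\<close>)
    moreover obtain as where "as \<in> B" using Bne by blast
    moreover from this have "as = s # tl as" "c as \<noteq> 0"
      using cons(1)[of as] by (auto simp: B_def A'_def)
    ultimately show False by force
  qed
  then show ?case by (auto simp: A'_def)
qed

text \<open>Exponents are bounded one by one, not by total degree, so that the monomials inject into
  the functions from \<open>F\<close> to \<open>{..D}\<close> and the count is bounded by a pure
  power.\<close>

definition box_polys :: "nat set \<Rightarrow> nat \<Rightarrow> 'k::field mpoly set" where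
  "box_polys F D = {p. \<forall>m\<in>Poly_Mapping.keys p.
     Poly_Mapping.keys m \<subseteq> F \<and> (\<forall>i. Poly_Mapping.lookup m i \<le> D)}"

lemma box_polys_times:
  assumes p: "p \<in> box_polys F D" and q: "q \<in> box_polys F E"
  shows "p * q \<in> box_polys F (D + E)"
  unfolding box_polys_def
proof (intro CollectI ballI)
  fix m assume "m \<in> Poly_Mapping.keys (p * q)"
  then obtain a b where "a \<in> Poly_Mapping.keys p" "b \<in> Poly_Mapping.keys q" "m = a + b"
    by (rule keys_times_subsetD)
  then show "Poly_Mapping.keys m \<subseteq> F \<and> (\<forall>i. Poly_Mapping.lookup m i \<le> D + E)"
    using p q by (simp add: box_polys_def keys_add_nat lookup_add add_mono)
qed

lemma box_polys_mono: "D \<le> E \<Longrightarrow> p \<in> box_polys F D \<Longrightarrow> p \<in> box_polys F E"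
  by (auto simp: box_polys_def intro: order_trans)

lemma box_polys_power: "p \<in> box_polys F D \<Longrightarrow> p ^ a \<in> box_polys F (a * D)"
  by (induction a) (auto simp: box_polys_times, auto simp: box_polys_def)

text \<open>Each of the \<open>length as\<close> factors contributes at most \<open>M * e\<close> to
  an exponent. What matters is that the bound is linear in \<open>M\<close>.\<close>

lemma box_polys_power_product:
  assumes "\<And>k. k < length as \<Longrightarrow> f k \<in> box_polys F e" and "\<And>a. a \<in> set as \<Longrightarrow> a \<le> M"
  shows "power_product f as \<in> box_polys F (length as * (M * e))"
  using assms
proof (induction as arbitrary: f)
  case Nil
  then show ?case by (simp add: box_polys_def)
next
  case (Cons a as)
  have "f 0 ^ a \<in> box_polys F (M * e)"
    using box_polys_power[of "f 0" F e a] Cons.prems(1)[of 0] Cons.prems(2)[of a]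
    by (auto elim: box_polys_mono[rotated])
  moreover have "power_product (\<lambda>k. f (Suc k)) as \<in> box_polys F (length as * (M * e))"
    by (rule Cons.IH) (use Cons.prems in auto)
  ultimately show ?case using box_polys_times by fastforce
qed

lemma box_polys_exists:
  fixes p :: "'k::field mpoly"
  assumes "\<And>m. m \<in> Poly_Mapping.keys p \<Longrightarrow> Poly_Mapping.keys m \<subseteq> F"
  shows "\<exists>D. p \<in> box_polys F D"
proof
  have "Poly_Mapping.lookup m i \<le> (\<Sum>m\<in>Poly_Mapping.keys p. \<Sum>i\<in>Poly_Mapping.keys m. Poly_Mapping.lookup m i)"
    if m: "m \<in> Poly_Mapping.keys p" for m i
  proof (cases "i \<in> Poly_Mapping.keys m")
    case True
    then have "Poly_Mapping.lookup m i \<le> (\<Sum>i\<in>Poly_Mapping.keys m. Poly_Mapping.lookup m i)"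
      by (intro member_le_sum) auto
    also have "\<dots> \<le> (\<Sum>m\<in>Poly_Mapping.keys p. \<Sum>i\<in>Poly_Mapping.keys m. Poly_Mapping.lookup m i)"
      using m by (intro member_le_sum) auto
    finally show ?thesis .
  qed (simp add: in_keys_iff)
  then show "p \<in> box_polys F (\<Sum>m\<in>Poly_Mapping.keys p. \<Sum>i\<in>Poly_Mapping.keys m. Poly_Mapping.lookup m i)"
    using assms by (auto simp: box_polys_def)
qed

lemma card_box_monomials:
  assumes "finite F"
  shows "finite {m :: nat \<Rightarrow>\<^sub>0 nat. Poly_Mapping.keys m \<subseteq> F \<and> (\<forall>i. Poly_Mapping.lookup m i \<le> D)}"
    and "card {m :: nat \<Rightarrow>\<^sub>0 nat. Poly_Mapping.keys m \<subseteq> F \<and> (\<forall>i. Poly_Mapping.lookup m i \<le> D)} \<le> Suc D ^ card F"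
proof -
  let ?X = "{m :: nat \<Rightarrow>\<^sub>0 nat. Poly_Mapping.keys m \<subseteq> F \<and> (\<forall>i. Poly_Mapping.lookup m i \<le> D)}"
  let ?g = "\<lambda>m :: nat \<Rightarrow>\<^sub>0 nat. restrict (Poly_Mapping.lookup m) F"
  have inj: "inj_on ?g ?X"
  proof (rule inj_onI, rule poly_mapping_eqI)
    fix m m' :: "nat \<Rightarrow>\<^sub>0 nat" and i assume mm: "m \<in> ?X" "m' \<in> ?X" "?g m = ?g m'"
    show "Poly_Mapping.lookup m i = Poly_Mapping.lookup m' i"
    proof (cases "i \<in> F")
      case True
      then show ?thesis using fun_cong[OF mm(3), of i] by simp
    next
      case False
      then have "i \<notin> Poly_Mapping.keys m" "i \<notin> Poly_Mapping.keys m'" using mm(1,2) by auto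
      then show ?thesis by (simp add: in_keys_iff)
    qed
  qed
  have sub: "?g ` ?X \<subseteq> PiE F (\<lambda>_. {..D})" by auto
  have fin: "finite (PiE F (\<lambda>_. {..D}))" using assms by (intro finite_PiE) auto
  show "finite ?X" using inj_on_finite[OF inj sub fin] .
  show "card ?X \<le> Suc D ^ card F"
    using card_inj_on_le[OF inj sub fin] assms by (simp add: card_PiE)
qed

text \<open>In \<open>M\<close>, the left side grows with degree \<open>l\<close> and the right side
  with degree at most \<open>d\<close>.\<close>

lemma nat_power_growth:
  fixes l d e :: nat
  assumes "\<And>M. Suc M ^ l \<le> Suc (l * (M * e)) ^ d"
  shows "l \<le> d"
proof (rule ccontr)
  assume "\<not> l \<le> d"
  \<comment> \<open>\<open>M\<close> is the constant factor that remains on the right after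
    \<open>Suc M ^ d\<close> is split off; the estimates then end in
    \<open>Suc M * Suc M ^ d \<le> M * Suc M ^ d\<close>.\<close>
  define M where "M = Suc (l * e) ^ d"
  have "Suc M * Suc M ^ d \<le> Suc M ^ l"
    using \<open>\<not> l \<le> d\<close> power_increasing[of "Suc d" l "Suc M"] by simp
  also have "\<dots> \<le> Suc (l * (M * e)) ^ d" by (rule assms)
  also have "\<dots> \<le> (Suc (l * e) * Suc M) ^ d" by (rule power_mono) (simp_all add: algebra_simps)
  also have "\<dots> = M * Suc M ^ d" by (simp only: power_mult_distrib M_def)
  finally show False by simp
qed

lemma prime_chain_length_le:
  fixes P :: "nat \<Rightarrow> 'k::field mpoly set"
  assumes "finite F" and prime: "\<And>k. k \<le> l \<Longrightarrow> primeideal (P k) (poly_ring n)"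
    and strict: "\<And>k. k < l \<Longrightarrow> P k \<subset> P (Suc k)" and F: "mono_ideal n {F} \<subseteq> P 0"
  shows "l \<le> card F"
proof -
  have idealP: "ideal (P k) (poly_ring n)" if "k \<le> l" for k
    using prime[OF that] by (rule primeideal.axioms(1))
  have P0: "P 0 \<subseteq> P k" if "k \<le> l" for k
    using that
  proof (induction k)
    case (Suc k)
    then show ?case using strict[of k] by auto
  qed simp
  \<comment> \<open>The terms of \<open>g\<close> not supported on \<open>F\<close> form an element
    of \<open>P 0\<close>, hence of every prime of the chain. Dropping them changes neither
    membership.\<close>
  have "\<exists>g e. g \<in> P (Suc k) \<and> g \<notin> P k \<and> g \<in> box_polys F e" if k: "k < l" for k
  proof -
    obtain g where g: "g \<in> P (Suc k)" "g \<notin> P k" using strict[OF k] by blast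
    have gc: "g \<in> carrier (poly_ring n)"
      using poly_ring_ideal_closed(3)[OF idealP g(1)] k by simp
    obtain q r where qr: "g = q + r"
      "Poly_Mapping.keys q = Poly_Mapping.keys g \<inter> {m. Poly_Mapping.keys m \<subseteq> F}"
      "Poly_Mapping.keys r = Poly_Mapping.keys g - {m. Poly_Mapping.keys m \<subseteq> F}"
      by (rule poly_mapping_split)
    have "r \<in> mono_ideal n {F}"
      using gc qr(3) by (auto simp: mono_ideal_def mem_carrier_poly_ring)
    then have r: "r \<in> P k" "r \<in> P (Suc k)" using F P0[of k] P0[of "Suc k"] k by auto
    have "q = g - r" using qr(1) by simp
    then have "q \<in> P (Suc k)" using poly_ring_ideal_closed(5)[OF idealP g(1) r(2)] k by simp
    moreover have "q \<notin> P k"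
      using poly_ring_ideal_closed(2)[OF idealP _ r(1), of q] k g(2) qr(1) by auto
    moreover have "\<exists>e. q \<in> box_polys F e" by (rule box_polys_exists) (use qr(2) in blast)
    ultimately show ?thesis by blast
  qed
  then obtain f e where f: "\<And>k. k < l \<Longrightarrow> f k \<in> P (Suc k)" "\<And>k. k < l \<Longrightarrow> f k \<notin> P k"
    and e: "\<And>k. k < l \<Longrightarrow> f k \<in> box_polys F (e k)" by metis
  \<comment> \<open>The sum serves as a common bound for the exponents of all chosen
    elements.\<close>
  have e': "f k \<in> box_polys F (sum e {..<l})" if "k < l" for k
    by (rule box_polys_mono[OF _ e[OF that]]) (use that in \<open>auto intro: member_le_sum\<close>)
  show ?thesis
  proof (rule nat_power_growth)
    fix M :: nat
    interpret V: vector_space "\<lambda>(c :: 'k) (p :: 'k mpoly). mconst c * p" by (rule vector_space_mpoly)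
    define D where "D = l * (M * sum e {..<l})"
    define L where "L = {as. set as \<subseteq> {..M} \<and> length as = l}"
    have finL: "finite L" and cardL: "card L = Suc M ^ l"
      using finite_lists_length_eq[of "{..M}" l] card_lists_length_eq[of "{..M}" l] by (simp_all add: L_def)
    have indep: "\<forall>as\<in>A. c as = 0"
      if "A \<subseteq> L" "(\<Sum>as\<in>A. mconst (c as) * power_product f as) = 0" for A and c :: "nat list \<Rightarrow> 'k"
    proof (rule prime_chain_independent[where P = P])
      show "finite A" using finL that(1) finite_subset by blast
      show "length as = l" if "as \<in> A" for as using that \<open>A \<subseteq> L\<close> by (auto simp: L_def)
      show "(\<Sum>as\<in>A. mconst (c as) * power_product f as) \<in> P 0"
        unfolding that(2) by (rule poly_ring_ideal_closed(1)[OF idealP]) simp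
    qed (use prime strict f in blast)+
    \<comment> \<open>Two lists with equal products would satisfy the relation with coefficients 1
      and -1. Without injectivity the count \<open>Suc M ^ l\<close> would not be reached.\<close>
    have inj: "inj_on (power_product f) L"
    proof (rule inj_onI, rule ccontr)
      fix as bs assume ab: "as \<in> L" "bs \<in> L" "power_product f as = power_product f bs" "as \<noteq> bs"
      have "\<forall>cs\<in>{as, bs}. (if cs = as then 1 else - 1 :: 'k) = 0"
        by (rule indep) (use ab in \<open>auto simp: mconst_simps\<close>)
      then show False by simp
    qed
    define X where "X = {m :: nat \<Rightarrow>\<^sub>0 nat. Poly_Mapping.keys m \<subseteq> F \<and> (\<forall>i. Poly_Mapping.lookup m i \<le> D)}"
    define T where "T = (\<lambda>m. Poly_Mapping.single m (1 :: 'k)) ` X"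
    have finX: "finite X" and cardX: "card X \<le> Suc D ^ card F"
      unfolding X_def using card_box_monomials[OF \<open>finite F\<close>] by blast+
    have "V.independent (power_product f ` L)"
    proof (rule V.independent_if_scalars_zero)
      show "finite (power_product f ` L)" using finL by simp
      fix c x assume "(\<Sum>x\<in>power_product f ` L. mconst (c x) * x) = 0" and x: "x \<in> power_product f ` L"
      then have "(\<Sum>as\<in>L. mconst (c (power_product f as)) * power_product f as) = 0"
        by (simp add: sum.reindex[OF inj])
      then show "c x = 0" using indep[of L "\<lambda>as. c (power_product f as)"] x by auto
    qed
    moreover have "power_product f ` L \<subseteq> V.span T"
    proof
      fix p assume "p \<in> power_product f ` L"
      then obtain as where as: "as \<in> L" "p = power_product f as" by blast
      have "p \<in> box_polys F (length as * (M * sum e {..<l}))"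
        unfolding as(2) by (rule box_polys_power_product) (use as e' in \<open>auto simp: L_def\<close>)
      then have keys: "Poly_Mapping.keys p \<subseteq> X" using as(1) by (auto simp: box_polys_def X_def L_def D_def)
      have "p = (\<Sum>m\<in>Poly_Mapping.keys p. mconst (Poly_Mapping.lookup p m) * Poly_Mapping.single m 1)"
        unfolding mconst_mult_single mult_1_right by (rule poly_mapping_sum_single)
      also have "\<dots> \<in> V.span T"
        by (intro V.span_sum V.span_scale V.span_base) (use keys in \<open>auto simp: T_def\<close>)
      finally show "p \<in> V.span T" .
    qed
    ultimately have "card (power_product f ` L) \<le> card T"
      using V.independent_span_bound[of T "power_product f ` L"] finX by (simp add: T_def)
    also have "\<dots> \<le> card X" unfolding T_def by (rule card_image_le[OF finX])
    finally show "Suc M ^ l \<le> Suc (l * (M * sum e {..<l})) ^ card F"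
      using cardX by (simp add: card_image[OF inj] cardL D_def)
  qed
qed

text \<open>The bottom prime of a chain contains the intersection of the \<open>P\<^sub>F\<close>,
  hence one of them, so the bound for a single \<open>F\<close> applies. The maximum is attained by
  an explicit chain.\<close>

lemma krull_dim_mono_ideal:
  assumes "finite S" and "S \<noteq> {}" and sub: "\<And>F. F \<in> S \<Longrightarrow> F \<subseteq> {1..n}"
  shows "krull_dim (poly_ring n Quot (mono_ideal n S :: 'k::field mpoly set)) = enat (Max (card ` S))"
proof -
  interpret cring "poly_ring n :: 'k mpoly ring" by (rule cring_poly_ring)
  have fin: "finite F" if "F \<in> S" for F using sub[OF that] finite_subset by blast
  let ?I = "mono_ideal n S :: 'k mpoly set"
  let ?chains = "{l. \<exists>P. (\<forall>k\<le>l. primeideal (P k) (poly_ring n) \<and> ?I \<subseteq> P k) \<and> (\<forall>k<l. P k \<subset> P (Suc k))}"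
  have "(SUP l\<in>?chains. enat l) = enat (Max (card ` S))"
  proof (rule antisym)
    show "(SUP l\<in>?chains. enat l) \<le> enat (Max (card ` S))"
    proof (rule SUP_least)
      fix l assume "l \<in> ?chains"
      then obtain P where P: "\<And>k. k \<le> l \<Longrightarrow> primeideal (P k) (poly_ring n)" "?I \<subseteq> P 0"
        "\<And>k. k < l \<Longrightarrow> P k \<subset> P (Suc k)" by blast
      have "\<exists>Q\<in>(\<lambda>F. mono_ideal n {F}) ` S. Q \<subseteq> P 0"
        by (rule primeideal_ideal_Inter[OF P(1)])
          (use assms(1) ideal_mono_ideal P(2) in \<open>auto simp: ideal_Inter_mono_ideal\<close>)
      then obtain F where F: "F \<in> S" "mono_ideal n {F} \<subseteq> P 0" by blast
      have "l \<le> card F"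
      proof (rule prime_chain_length_le[OF fin[OF F(1)]])
        show "mono_ideal n {F} \<subseteq> P 0" by (rule F(2))
      qed (use P in simp_all)
      also have "\<dots> \<le> Max (card ` S)" using F(1) assms(1) by simp
      finally show "enat l \<le> enat (Max (card ` S))" by simp
    qed
    have "Max (card ` S) \<in> card ` S" using assms(1,2) by (intro Max_in) auto
    then obtain F where F: "F \<in> S" "card F = Max (card ` S)" by (metis imageE)
    \<comment> \<open>Deleting the elements of a largest \<open>F\<close> one at a time enlarges the
      prime at each step, from \<open>P\<^sub>F\<close> up to the ideal of polynomials without
      constant term.\<close>
    define xs where "xs = sorted_list_of_set F"
    have xs: "set xs = F" "distinct xs" "length xs = card F" using fin[OF F(1)] by (simp_all add: xs_def)
    define P where "P k = (mono_ideal n {set (drop k xs)} :: 'k mpoly set)" for k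
    have dropsub: "set (drop k xs) \<subseteq> {1..n}" for k
      using set_drop_subset[of k xs] xs(1) sub[OF F(1)] by auto
    have "P k \<subset> P (Suc k)" if k: "k < card F" for k
    proof -
      have "drop k xs = xs ! k # drop (Suc k) xs" using k xs(3) by (simp add: Cons_nth_drop_Suc)
      then have "set (drop k xs) = insert (xs ! k) (set (drop (Suc k) xs))" "xs ! k \<notin> set (drop (Suc k) xs)"
        using distinct_drop[OF xs(2), of k] by auto
      then show ?thesis
        unfolding P_def less_le_not_le mono_ideal_subset_iff[OF dropsub] by auto
    qed
    moreover have "?I \<subseteq> P k" for k
      using F(1) set_drop_subset[of k xs] xs(1) unfolding P_def mono_ideal_def by blast
    moreover have "primeideal (P k) (poly_ring n)" for k
      unfolding P_def by (rule primeideal_mono_ideal)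
    ultimately have "card F \<in> ?chains" by blast
    then show "enat (Max (card ` S)) \<le> (SUP l\<in>?chains. enat l)"
      unfolding F(2)[symmetric] by (rule SUP_upper)
  qed
  then show ?thesis unfolding krull_dim_quot[OF ideal_mono_ideal] .
qed

section \<open>The dimension filtration of a face ring\<close>

lemma simplicial_complex_finite:
  assumes "simplicial_complex n \<Delta>"
  shows "finite \<Delta>" and "\<And>F. F \<in> \<Delta> \<Longrightarrow> F \<subseteq> {1..n}" and "\<And>F. F \<in> \<Delta> \<Longrightarrow> finite F"
proof -
  have sub: "F \<subseteq> {1..n}" if "F \<in> \<Delta>" for F
    using assms that unfolding simplicial_complex_def by blast
  then show "\<And>F. F \<in> \<Delta> \<Longrightarrow> F \<subseteq> {1..n}" .
  have "\<Delta> \<subseteq> Pow {1..n}" using sub by blast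
  then show "finite \<Delta>" by (rule finite_subset) simp
  show "\<And>F. F \<in> \<Delta> \<Longrightarrow> finite F" using sub finite_subset by blast
qed

definition facets :: "nat set set \<Rightarrow> nat set set" where
  "facets \<Delta> = {F\<in>\<Delta>. \<forall>G\<in>\<Delta>. F \<subseteq> G \<longrightarrow> F = G}"

lemma face_subset_facet:
  assumes \<Delta>: "simplicial_complex n \<Delta>" and "F \<in> \<Delta>"
  shows "\<exists>G\<in>facets \<Delta>. F \<subseteq> G"
  using finite_has_maximal2[OF simplicial_complex_finite(1)[OF \<Delta>] \<open>F \<in> \<Delta>\<close>]
  unfolding facets_def by blast

lemma dim_filtration_mono_ideal:
  assumes \<Delta>: "simplicial_complex n \<Delta>"
  shows "dim_filtration (poly_ring n) (mono_ideal n \<Delta> :: 'k::field mpoly set) i =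
    mono_ideal n {F\<in>\<Delta>. int (card F) > i}"
proof -
  interpret cring "poly_ring n :: 'k mpoly ring" by (rule cring_poly_ring)
  note \<Delta>_fin = simplicial_complex_finite[OF \<Delta>]
  have facetD: "F \<in> \<Delta>" if "F \<in> facets \<Delta>" for F using that by (simp add: facets_def)
  have facet_eq: "F = G" if "F \<in> facets \<Delta>" "G \<in> \<Delta>" "F \<subseteq> G" for F G
    using that by (simp add: facets_def)
  let ?\<P> = "(\<lambda>F. mono_ideal n {F} :: 'k mpoly set) ` facets \<Delta>"
  have "finite (facets \<Delta>)" using \<Delta>_fin(1) by (simp add: facets_def)
  then have fin\<P>: "finite ?\<P>" by simp
  have I: "mono_ideal n \<Delta> = ideal_Inter (poly_ring n) ?\<P>"
    unfolding ideal_Inter_mono_ideal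
    by (rule mono_ideal_cong) (meson face_subset_facet[OF \<Delta>] facetD order_trans)
  have iff: "reduced_primary_decomposition (poly_ring n) (ideal_Inter (poly_ring n) ?\<P>) \<Q> \<longleftrightarrow> \<Q> = ?\<P>" for \<Q>
  proof (rule reduced_primary_decomposition_primes_iff[OF fin\<P>])
    show "primeideal P (poly_ring n)" if "P \<in> ?\<P>" for P
      using that primeideal_mono_ideal by blast
    fix P P' assume "P \<in> ?\<P>" "P' \<in> ?\<P>" "P \<subseteq> P'"
    then obtain F F' where F: "F \<in> facets \<Delta>" "P = mono_ideal n {F}" "F' \<in> facets \<Delta>" "P' = mono_ideal n {F'}"
      by blast
    then have "F' \<subseteq> F"
      using \<open>P \<subseteq> P'\<close> mono_ideal_subset_iff[OF \<Delta>_fin(2)[OF facetD[OF F(3)]], where 'k = 'k] by simp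
    then have "F' = F" using facet_eq F facetD by blast
    then show "P = P'" using F by simp
  qed
  have dim: "int (the_enat (krull_dim (poly_ring n Quot radical_ideal (poly_ring n) (mono_ideal n {F} :: 'k mpoly set)))) = int (card F)"
    if "F \<in> facets \<Delta>" for F
    using krull_dim_mono_ideal[of "{F}" n, where 'k = 'k] \<Delta>_fin(2)[OF facetD[OF that]]
    by (simp add: radical_ideal_primeideal[OF primeideal_mono_ideal])
  have "dim_filtration (poly_ring n) (mono_ideal n \<Delta> :: 'k mpoly set) i =
    ideal_Inter (poly_ring n) {Q\<in>?\<P>. int (the_enat (krull_dim (poly_ring n Quot radical_ideal (poly_ring n) Q))) > i}"
    \<comment> \<open>The decomposition being unique, the existential in the description has a
      single witness.\<close>
    unfolding dim_filtration_def I iff by (rule the_equality) auto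
  also have "{Q\<in>?\<P>. int (the_enat (krull_dim (poly_ring n Quot radical_ideal (poly_ring n) Q))) > i} =
    (\<lambda>F. mono_ideal n {F}) ` {F\<in>facets \<Delta>. int (card F) > i}"
    using dim by auto
  also have "ideal_Inter (poly_ring n) \<dots> = (mono_ideal n {F\<in>facets \<Delta>. int (card F) > i} :: 'k mpoly set)"
    by (rule ideal_Inter_mono_ideal)
  also have "\<dots> = mono_ideal n {F\<in>\<Delta>. int (card F) > i}"
  proof (rule mono_ideal_cong)
    fix \<sigma>
    show "(\<exists>F\<in>{F\<in>facets \<Delta>. int (card F) > i}. \<sigma> \<subseteq> F) \<longleftrightarrow> (\<exists>F\<in>{F\<in>\<Delta>. int (card F) > i}. \<sigma> \<subseteq> F)"
    proof
      assume "\<exists>F\<in>{F\<in>\<Delta>. int (card F) > i}. \<sigma> \<subseteq> F"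
      then obtain F where F: "F \<in> \<Delta>" "int (card F) > i" "\<sigma> \<subseteq> F" by blast
      obtain G where G: "G \<in> facets \<Delta>" "F \<subseteq> G" using face_subset_facet[OF \<Delta> F(1)] by blast
      have "card F \<le> card G" using \<Delta>_fin(3)[OF facetD[OF G(1)]] G(2) by (rule card_mono)
      then show "\<exists>F\<in>{F\<in>facets \<Delta>. int (card F) > i}. \<sigma> \<subseteq> F" using F G by force
    qed (use facetD in blast)
  qed
  finally show ?thesis .
qed

section \<open>Hilbert series\<close>

lemma subfield_mconst: "subfield (range mconst) (poly_ring n :: 'k::field mpoly ring)"
proof -
  interpret cring "poly_ring n :: 'k mpoly ring" by (rule cring_poly_ring)
  have zero_iff: "mconst c = 0 \<longleftrightarrow> c = (0 :: 'k)" for c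
    unfolding mconst_def by (metis lookup_single_eq lookup_zero single_zero)
  show ?thesis
  proof (rule subfieldI, rule subcringI', rule subringI)
    show "range mconst \<subseteq> carrier (poly_ring n :: 'k mpoly ring)" using mconst_closed by blast
    show "\<one>\<^bsub>poly_ring n\<^esub> \<in> range (mconst :: 'k \<Rightarrow> _)"
      unfolding poly_ring_simps using mconst_simps(4) by (metis rangeI)
    show "\<ominus>\<^bsub>poly_ring n\<^esub> h \<in> range mconst" if h: "h \<in> range mconst" for h :: "'k mpoly"
    proof -
      obtain c where "h = mconst c" using h by blast
      then have "\<ominus>\<^bsub>poly_ring n\<^esub> h = mconst (- c)"
        by (simp add: a_inv_poly_ring mconst_closed mconst_simps)
      then show ?thesis by blast
    qed
    show "h \<otimes>\<^bsub>poly_ring n\<^esub> h' \<in> range mconst" "h \<oplus>\<^bsub>poly_ring n\<^esub> h' \<in> range mconst"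
      if "h \<in> range mconst" "h' \<in> range mconst" for h h' :: "'k mpoly"
      using that unfolding poly_ring_simps by (auto simp flip: mconst_simps)
    show "Units (poly_ring n \<lparr>carrier := range (mconst :: 'k \<Rightarrow> _)\<rparr>) = range mconst - {\<zero>\<^bsub>poly_ring n\<^esub>}"
    proof (intro equalityI subsetI)
      fix u assume u: "u \<in> Units (poly_ring n \<lparr>carrier := range (mconst :: 'k \<Rightarrow> _)\<rparr>)"
      then have "u \<noteq> 0" by (auto simp: Units_def poly_ring_simps)
      then show "u \<in> range mconst - {\<zero>\<^bsub>poly_ring n\<^esub>}"
        using u by (auto simp: Units_def poly_ring_simps)
    next
      fix u assume "u \<in> range (mconst :: 'k \<Rightarrow> _) - {\<zero>\<^bsub>poly_ring n\<^esub>}"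
      then obtain c :: 'k where c: "u = mconst c" "c \<noteq> 0"
        using mconst_simps(3) by (auto simp: poly_ring_simps)
      have "mconst (inverse c) * mconst c = 1" "mconst c * mconst (inverse c) = 1"
        using c(2) by (simp_all flip: mconst_simps)
      then show "u \<in> Units (poly_ring n \<lparr>carrier := range (mconst :: 'k \<Rightarrow> _)\<rparr>)"
        unfolding Units_def using c(1) by (auto simp: poly_ring_simps)
    qed
  qed
qed

section \<open>Vector space dimension of spaces of cosets modulo a monomial ideal\<close>

context
  fixes n :: nat and S :: "nat set set" and J :: "'k::field mpoly set"
  assumes J: "J = mono_ideal n S"
begin

private lemma idealJ: "ideal J (poly_ring n)"
  unfolding J by (rule ideal_mono_ideal)

lemma rcos_mono_ideal_simps:
  assumes "p \<in> carrier (poly_ring n)" "q \<in> carrier (poly_ring n)"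
  shows "(J +>\<^bsub>poly_ring n\<^esub> p) \<oplus>\<^bsub>poly_ring n Quot J\<^esub> (J +>\<^bsub>poly_ring n\<^esub> q) = J +>\<^bsub>poly_ring n\<^esub> (p + q)"
    and "(J +>\<^bsub>poly_ring n\<^esub> p) \<otimes>\<^bsub>poly_ring n Quot J\<^esub> (J +>\<^bsub>poly_ring n\<^esub> q) = J +>\<^bsub>poly_ring n\<^esub> (p * q)"
    and "J +>\<^bsub>poly_ring n\<^esub> p \<in> carrier (poly_ring n Quot J)"
  using ring_hom_add[OF ideal.rcos_ring_hom[OF idealJ] assms]
    ring_hom_mult[OF ideal.rcos_ring_hom[OF idealJ] assms]
    ring_hom_closed[OF ideal.rcos_ring_hom[OF idealJ] assms(1)]
  by (simp_all only: poly_ring_simps)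

lemma rcos_mono_ideal_eq_iff:
  assumes "p \<in> carrier (poly_ring n)" "q \<in> carrier (poly_ring n)"
  shows "J +>\<^bsub>poly_ring n\<^esub> p = J +>\<^bsub>poly_ring n\<^esub> q \<longleftrightarrow> p - q \<in> J"
proof -
  interpret cring "poly_ring n :: 'k mpoly ring" by (rule cring_poly_ring)
  have "p \<ominus>\<^bsub>poly_ring n\<^esub> q = p - q"
    using assms by (simp add: a_minus_def a_inv_poly_ring poly_ring_simps)
  then show ?thesis
    using quotient_eq_iff_same_a_r_cos[OF idealJ assms] by simp
qed

text \<open>A nonempty \<open>S\<close> keeps 1 out of \<open>J\<close>, so the quotient is nonzero
  and the field of constants maps onto a subfield.\<close>

lemma subfield_rcos_mconst:
  assumes "S \<noteq> {}"
  shows "subfield (range (\<lambda>c. J +>\<^bsub>poly_ring n\<^esub> mconst c)) (poly_ring n Quot J)"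
proof -
  interpret Q: ring "poly_ring n Quot J" by (rule ideal.quotient_is_ring[OF idealJ])
  have "\<one>\<^bsub>poly_ring n Quot J\<^esub> = J +>\<^bsub>poly_ring n\<^esub> 1"
    by (simp add: FactRing_def poly_ring_simps)
  moreover have "\<zero>\<^bsub>poly_ring n Quot J\<^esub> = J +>\<^bsub>poly_ring n\<^esub> 0"
    using ring_hom_zero[OF ideal.rcos_ring_hom[OF idealJ] cring.axioms(1)[OF cring_poly_ring] Q.ring_axioms]
    by (simp add: poly_ring_simps)
  moreover have "(1 :: 'k mpoly) - 0 \<notin> J" using assms by (simp add: J one_mem_mono_ideal_iff)
  ultimately have "\<one>\<^bsub>poly_ring n Quot J\<^esub> \<noteq> \<zero>\<^bsub>poly_ring n Quot J\<^esub>"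
    using rcos_mono_ideal_eq_iff[OF poly_ring_closed(2,1)] by simp
  from ring_hom_ring.img_is_subfield(2)[OF ideal.rcos_ring_hom_ring[OF idealJ] subfield_mconst this]
  show ?thesis by (simp add: image_image)
qed

text \<open>\<open>J\<close> contains no polynomial in which a monomial of \<open>B\<close> occurs.
  Thus the coset of a new monomial is never among the combinations of earlier ones, and each
  monomial extends the space by one line.\<close>

lemma dimension_rcos_mono_ideal:
  fixes B :: "(nat \<Rightarrow>\<^sub>0 nat) set"
  assumes "finite B" and "\<And>m. m \<in> B \<Longrightarrow> Poly_Mapping.keys m \<subseteq> {1..n}"
    and "\<And>m. m \<in> B \<Longrightarrow> \<exists>F\<in>S. Poly_Mapping.keys m \<subseteq> F"
  shows "ring.dimension (poly_ring n Quot J) (card B) (range (\<lambda>c. J +>\<^bsub>poly_ring n\<^esub> mconst c))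
    ((\<lambda>p. J +>\<^bsub>poly_ring n\<^esub> p) ` {p. Poly_Mapping.keys p \<subseteq> B})"
  using assms
proof (induction B rule: finite_induct)
  case empty
  interpret Q: ring "poly_ring n Quot J" by (rule ideal.quotient_is_ring[OF idealJ])
  have "\<zero>\<^bsub>poly_ring n Quot J\<^esub> = J +>\<^bsub>poly_ring n\<^esub> 0"
    using ring_hom_zero[OF ideal.rcos_ring_hom[OF idealJ] cring.axioms(1)[OF cring_poly_ring] Q.ring_axioms]
    by (simp add: poly_ring_simps)
  then show ?case using Q.zero_dim by simp
next
  case (insert m B)
  interpret Q: ring "poly_ring n Quot J" by (rule ideal.quotient_is_ring[OF idealJ])
  let ?h = "\<lambda>p. J +>\<^bsub>poly_ring n\<^esub> p"
  let ?E = "?h ` {p. Poly_Mapping.keys p \<subseteq> B}" and ?K = "range (\<lambda>c. ?h (mconst c))"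
  let ?m = "Poly_Mapping.single m (1 :: 'k)"
  have carr: "p \<in> carrier (poly_ring n)" if "Poly_Mapping.keys p \<subseteq> insert m B" for p :: "'k mpoly"
    using that insert.prems(1) unfolding mem_carrier_poly_ring by blast
  have mc: "?m \<in> carrier (poly_ring n)" by (rule carr) simp
  have notin: "?h ?m \<notin> ?E"
  proof
    assume "?h ?m \<in> ?E"
    then obtain p where p: "Poly_Mapping.keys p \<subseteq> B" "?h ?m = ?h p" by blast
    have "?m - p \<in> J" using rcos_mono_ideal_eq_iff[OF mc carr] p by blast
    moreover have "m \<notin> Poly_Mapping.keys p" using p(1) insert.hyps(2) by blast
    then have "m \<in> Poly_Mapping.keys (?m - p)" by (simp add: in_keys_iff lookup_minus)
    ultimately show False using insert.prems(2)[of m] unfolding J mono_ideal_def by blast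
  qed
  have "Q.line_extension ?K (?h ?m) ?E = ?h ` {p. Poly_Mapping.keys p \<subseteq> insert m B}"
  proof (intro equalityI subsetI)
    fix x assume "x \<in> Q.line_extension ?K (?h ?m) ?E"
    then obtain c p where p: "Poly_Mapping.keys p \<subseteq> B"
      and x: "x = (?h (mconst c) \<otimes>\<^bsub>poly_ring n Quot J\<^esub> ?h ?m) \<oplus>\<^bsub>poly_ring n Quot J\<^esub> ?h p"
      unfolding Q.line_extension_mem_iff by blast
    have "x = ?h (Poly_Mapping.single m c + p)"
      unfolding x rcos_mono_ideal_simps(2)[OF mconst_closed mc] mconst_mult_single mult_1_right
      by (rule rcos_mono_ideal_simps(1)) (rule carr, use p in auto)+
    moreover have "Poly_Mapping.keys (Poly_Mapping.single m c + p) \<subseteq> insert m B"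
      using Poly_Mapping.keys_add[of "Poly_Mapping.single m c" p] p by (auto split: if_splits)
    ultimately show "x \<in> ?h ` {p. Poly_Mapping.keys p \<subseteq> insert m B}" by blast
  next
    fix x assume "x \<in> ?h ` {p. Poly_Mapping.keys p \<subseteq> insert m B}"
    then obtain p where p: "Poly_Mapping.keys p \<subseteq> insert m B" "x = ?h p" by blast
    define c q where "c = Poly_Mapping.lookup p m" and "q = p - Poly_Mapping.single m c"
    have q: "Poly_Mapping.keys q \<subseteq> B"
    proof
      fix a assume a: "a \<in> Poly_Mapping.keys q"
      then have "a \<noteq> m" by (auto simp: q_def c_def in_keys_iff lookup_minus)
      then have "a \<in> Poly_Mapping.keys p"
        using a by (simp add: q_def in_keys_iff lookup_minus lookup_single_not_eq)
      then show "a \<in> B" using p(1) \<open>a \<noteq> m\<close> by blast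
    qed
    have "x = ?h (Poly_Mapping.single m c + q)" by (simp add: p(2) q_def)
    also have "\<dots> = (?h (mconst c) \<otimes>\<^bsub>poly_ring n Quot J\<^esub> ?h ?m) \<oplus>\<^bsub>poly_ring n Quot J\<^esub> ?h q"
      unfolding rcos_mono_ideal_simps(2)[OF mconst_closed mc] mconst_mult_single mult_1_right
      by (rule rcos_mono_ideal_simps(1)[symmetric]) (rule carr, use q in auto)+
    finally show "x \<in> Q.line_extension ?K (?h ?m) ?E"
      unfolding Q.line_extension_mem_iff using q by blast
  qed
  moreover have "Q.dimension (Suc (card B)) ?K (Q.line_extension ?K (?h ?m) ?E)"
    by (rule Q.Suc_dim[OF rcos_mono_ideal_simps(3)[OF mc mc] notin insert.IH]) (use insert.prems in auto)
  ultimately show ?case using insert.hyps by simp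
qed

end

section \<open>Counting monomials by degree and support\<close>

lemma monomial_degree_superset:
  "finite A \<Longrightarrow> Poly_Mapping.keys m \<subseteq> A \<Longrightarrow> monomial_degree m = (\<Sum>i\<in>A. Poly_Mapping.lookup m i)"
  unfolding monomial_degree_def by (rule sum.mono_neutral_left) (auto simp: in_keys_iff)

lemma lookup_le_monomial_degree: "Poly_Mapping.lookup m i \<le> monomial_degree m"
  by (subst monomial_degree_superset[of "insert i (Poly_Mapping.keys m)"])
    (auto intro!: member_le_sum simp del: sum.insert_if)

lemma finite_monomials:
  assumes "finite F"
  shows "finite {m. Poly_Mapping.keys m \<subseteq> F \<and> monomial_degree m = j}"
  by (rule finite_subset[OF _ card_box_monomials(1)[OF assms, of j]])
    (auto intro: lookup_le_monomial_degree)

text \<open>The maximum is split into the two conditions that a monomial with support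
  \<open>\<sigma>\<close> lies outside stage \<open>i - 1\<close> of the filtration and inside stage
  \<open>i\<close>.\<close>

lemma face_degree_eq_iff:
  assumes \<Delta>: "simplicial_complex n \<Delta>" and "\<sigma> \<in> \<Delta>"
  shows "face_degree \<Delta> \<sigma> = i \<longleftrightarrow>
    (\<exists>F\<in>\<Delta>. \<sigma> \<subseteq> F \<and> i \<le> card F) \<and> \<not> (\<exists>F\<in>\<Delta>. \<sigma> \<subseteq> F \<and> i < card F)"
proof -
  let ?A = "card ` {F \<in> \<Delta>. \<sigma> \<subseteq> F}"
  have "finite ?A" using simplicial_complex_finite(1)[OF \<Delta>] by simp
  moreover have "?A \<noteq> {}" using \<open>\<sigma> \<in> \<Delta>\<close> by blast
  ultimately show ?thesis
    unfolding face_degree_def by (subst Max_eq_iff) (auto simp: not_less intro: le_antisym)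
qed

text \<open>The face \<open>F\<^sub>0\<close> expresses that \<open>i\<close> is at most the
  dimension of the face ring; it makes \<open>S\<close> nonempty, so that the scalars form a field
  in the quotient by \<open>J\<close>.\<close>

lemma U_dim_mono_ideal:
  assumes \<Delta>: "simplicial_complex n \<Delta>" and i: "F\<^sub>0 \<in> \<Delta>" "i \<le> card F\<^sub>0"
  shows "U_dim n (mono_ideal n \<Delta> :: 'k::field mpoly set) i j =
    card {m. Poly_Mapping.keys m \<in> \<Delta> \<and> face_degree \<Delta> (Poly_Mapping.keys m) = i \<and> monomial_degree m = j}"
proof -
  note \<Delta>_fin = simplicial_complex_finite[OF \<Delta>]
  define S where "S = {F\<in>\<Delta>. i \<le> card F}"
  define J where "J = (mono_ideal n S :: 'k mpoly set)"
  define T where "T = {F\<in>\<Delta>. i < card F}"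
  define B where "B = {m. Poly_Mapping.keys m \<in> \<Delta> \<and> face_degree \<Delta> (Poly_Mapping.keys m) = i \<and> monomial_degree m = j}"
  have eqJ: "dim_filtration (poly_ring n) (mono_ideal n \<Delta>) (int i - 1) = J"
    \<comment> \<open>\<open>card F > i - 1\<close> over the integers is
      \<open>i \<le> card F\<close>; at \<open>i = 0\<close> the index is -1 and every face
      counts.\<close>
    unfolding dim_filtration_mono_ideal[OF \<Delta>] J_def S_def by (rule arg_cong[where f = "mono_ideal n"]) auto
  have eqT: "dim_filtration (poly_ring n) (mono_ideal n \<Delta>) (int i) = (mono_ideal n T :: 'k mpoly set)"
    unfolding dim_filtration_mono_ideal[OF \<Delta>] T_def by simp
  have B: "m \<in> B \<longleftrightarrow> (\<exists>F\<in>S. Poly_Mapping.keys m \<subseteq> F) \<and> \<not> (\<exists>F\<in>T. Poly_Mapping.keys m \<subseteq> F) \<and> monomial_degree m = j" for m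
  proof -
    have "Poly_Mapping.keys m \<in> \<Delta>" if "F \<in> S" "Poly_Mapping.keys m \<subseteq> F" for F
      using that \<Delta> unfolding S_def simplicial_complex_def by blast
    then show ?thesis
      unfolding B_def using face_degree_eq_iff[OF \<Delta>, of "Poly_Mapping.keys m" i]
      by (auto simp: S_def T_def)
  qed
  have BS: "\<exists>F\<in>S. Poly_Mapping.keys m \<subseteq> F" if "m \<in> B" for m
    using that unfolding B by (rule conjunct1)
  have keysB: "Poly_Mapping.keys m \<subseteq> {1..n}" if "m \<in> B" for m
    using that \<Delta>_fin(2) unfolding B_def by blast
  have finB: "finite B"
    by (rule finite_subset[OF _ finite_monomials[of "{1..n}" j]]) (use keysB in \<open>auto simp: B_def\<close>)
  interpret Q: ring "poly_ring n Quot J"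
    unfolding J_def by (rule ideal.quotient_is_ring[OF ideal_mono_ideal])
  let ?K = "range (\<lambda>c. J +>\<^bsub>poly_ring n\<^esub> mconst c)"
  have "U_piece n (mono_ideal n \<Delta>) i j = (\<lambda>p. J +>\<^bsub>poly_ring n\<^esub> p) ` {p. Poly_Mapping.keys p \<subseteq> B}"
    unfolding U_piece_def eqJ eqT
  proof (intro equalityI subsetI)
    fix x assume "x \<in> (\<lambda>p. J +>\<^bsub>poly_ring n\<^esub> p) ` (mono_ideal n T \<inter> graded_piece n j)"
    then obtain p where p: "p \<in> mono_ideal n T" "p \<in> graded_piece n j" "x = J +>\<^bsub>poly_ring n\<^esub> p" by blast
    \<comment> \<open>\<open>q\<close> keeps the terms outside \<open>J\<close> and represents the
      same coset. Its monomials also satisfy the conditions on \<open>p\<close>, which places them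
      in \<open>B\<close>.\<close>
    obtain q r where qr: "p = q + r"
      "Poly_Mapping.keys q = Poly_Mapping.keys p \<inter> {m. \<exists>F\<in>S. Poly_Mapping.keys m \<subseteq> F}"
      "Poly_Mapping.keys r = Poly_Mapping.keys p - {m. \<exists>F\<in>S. Poly_Mapping.keys m \<subseteq> F}"
      by (rule poly_mapping_split)
    have pc: "p \<in> carrier (poly_ring n)" using p(1) by (simp add: mono_ideal_def)
    then have qc: "q \<in> carrier (poly_ring n)" and "r \<in> J"
      using qr(2,3) by (auto simp: mem_carrier_poly_ring J_def mono_ideal_def)
    then have "x = J +>\<^bsub>poly_ring n\<^esub> q"
      using rcos_mono_ideal_eq_iff[OF J_def pc qc] p(3) qr(1) by simp
    moreover have "Poly_Mapping.keys q \<subseteq> B"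
      using p(1,2) qr(2) B unfolding mono_ideal_def graded_piece_def by blast
    ultimately show "x \<in> (\<lambda>p. J +>\<^bsub>poly_ring n\<^esub> p) ` {p. Poly_Mapping.keys p \<subseteq> B}" by blast
  next
    fix x assume "x \<in> (\<lambda>p. J +>\<^bsub>poly_ring n\<^esub> p) ` {p. Poly_Mapping.keys p \<subseteq> B}"
    then obtain p where p: "Poly_Mapping.keys p \<subseteq> B" "x = J +>\<^bsub>poly_ring n\<^esub> p" by blast
    have "p \<in> carrier (poly_ring n)" using p(1) keysB unfolding mem_carrier_poly_ring by blast
    then have "p \<in> mono_ideal n T \<inter> graded_piece n j"
      using p(1) B unfolding mono_ideal_def graded_piece_def by blast
    then show "x \<in> (\<lambda>p. J +>\<^bsub>poly_ring n\<^esub> p) ` (mono_ideal n T \<inter> graded_piece n j)" using p(2) by blast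
  qed
  moreover have "Q.dimension (card B) ?K ((\<lambda>p. J +>\<^bsub>poly_ring n\<^esub> p) ` {p. Poly_Mapping.keys p \<subseteq> B})"
    by (rule dimension_rcos_mono_ideal[OF J_def finB keysB BS])
  moreover have "subfield ?K (poly_ring n Quot J)"
    by (rule subfield_rcos_mconst[OF J_def]) (use i in \<open>auto simp: S_def\<close>)
  ultimately have "Q.dim ?K (U_piece n (mono_ideal n \<Delta>) i j) = card B"
    using Q.dimI by (simp add: over_def)
  then show ?thesis by (simp add: U_dim_def eqJ Let_def B_def)
qed

lemma monomial_degree_add: "monomial_degree (a + b) = monomial_degree a + monomial_degree b"
proof -
  let ?A = "Poly_Mapping.keys a \<union> Poly_Mapping.keys b"
  have "monomial_degree (a + b) = (\<Sum>i\<in>?A. Poly_Mapping.lookup (a + b) i)"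
    by (rule monomial_degree_superset) (simp_all add: keys_add_nat)
  also have "\<dots> = monomial_degree a + monomial_degree b"
    by (simp add: lookup_add sum.distrib monomial_degree_superset[of ?A])
  finally show ?thesis .
qed

lemma monomial_degree_single: "monomial_degree (Poly_Mapping.single x c) = c"
  by (simp add: monomial_degree_def)

definition support_series :: "nat set \<Rightarrow> int fps" where
  "support_series \<sigma> = Abs_fps (\<lambda>j. int (card {m. Poly_Mapping.keys m = \<sigma> \<and> monomial_degree m = j}))"

text \<open>A monomial with support \<open>insert x \<sigma>\<close> is \<open>x\<close> times a monomial with support either
  \<open>insert x \<sigma>\<close> or \<open>\<sigma>\<close>.\<close>

lemma support_series_insert:
  assumes "finite \<sigma>" "x \<notin> \<sigma>"
  shows "support_series (insert x \<sigma>) * (1 - fps_X) = fps_X * support_series \<sigma>"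
proof (rule fps_ext)
  fix j
  define M where "M \<tau> j = {m. Poly_Mapping.keys m = \<tau> \<and> monomial_degree m = j}" for \<tau> j
  have fin: "finite (M \<tau> j)" if "finite \<tau>" for \<tau> j
    by (rule finite_subset[OF _ finite_monomials[OF that, of j]]) (auto simp: M_def)
  have nth: "fps_nth (support_series \<tau>) j = int (card (M \<tau> j))" for \<tau> j
    by (simp add: support_series_def M_def)
  show "fps_nth (support_series (insert x \<sigma>) * (1 - fps_X)) j = fps_nth (fps_X * support_series \<sigma>) j"
  proof (cases j)
    case 0
    have "M (insert x \<sigma>) 0 = {}"
    proof -
      have "0 < monomial_degree m" if "Poly_Mapping.keys m = insert x \<sigma>" for m
      proof -
        have "x \<in> Poly_Mapping.keys m" using that by simp
        then have "Poly_Mapping.lookup m x \<noteq> 0" by (simp only: in_keys_iff not_False_eq_True)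
        then show ?thesis using lookup_le_monomial_degree[of m x] by linarith
      qed
      then show ?thesis by (fastforce simp: M_def)
    qed
    then show ?thesis using 0 by (simp add: algebra_simps nth)
  next
    case (Suc j')
    let ?x = "Poly_Mapping.single x (1 :: nat)"
    \<comment> \<open>In degree \<open>Suc j'\<close> the series identity says that
      \<open>M (insert x \<sigma>) (Suc j')\<close> has as many elements as
      \<open>M (insert x \<sigma>) j'\<close> and \<open>M \<sigma> j'\<close> together.\<close>
    have "M (insert x \<sigma>) (Suc j') = (\<lambda>m. m + ?x) ` (M (insert x \<sigma>) j' \<union> M \<sigma> j')"
    proof (intro equalityI subsetI)
      fix m assume m: "m \<in> M (insert x \<sigma>) (Suc j')"
      have "Poly_Mapping.lookup m x \<noteq> 0" using m unfolding in_keys_iff[symmetric] M_def by simp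
      then have eq: "m = (m - ?x) + ?x"
        by (intro poly_mapping_eqI) (auto simp: lookup_add lookup_minus lookup_single when_def)
      have "monomial_degree m = monomial_degree (m - ?x) + 1"
        by (subst eq) (simp only: monomial_degree_add monomial_degree_single)
      then have "monomial_degree (m - ?x) = j'" using m by (simp add: M_def)
      moreover have "insert x (Poly_Mapping.keys (m - ?x)) = insert x \<sigma>"
        using m keys_add_nat[of "m - ?x" ?x] eq by (simp add: M_def)
      then have "Poly_Mapping.keys (m - ?x) = insert x \<sigma> \<or> Poly_Mapping.keys (m - ?x) = \<sigma>"
        using assms(2) by (metis insert_absorb insert_ident)
      ultimately have "m - ?x \<in> M (insert x \<sigma>) j' \<union> M \<sigma> j'"
        unfolding M_def Un_iff mem_Collect_eq by blast
      then show "m \<in> (\<lambda>m. m + ?x) ` (M (insert x \<sigma>) j' \<union> M \<sigma> j')" using eq by (rule image_eqI[rotated])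
    next
      fix m' assume "m' \<in> (\<lambda>m. m + ?x) ` (M (insert x \<sigma>) j' \<union> M \<sigma> j')"
      then obtain m where m: "m' = m + ?x" "m \<in> M (insert x \<sigma>) j' \<union> M \<sigma> j'" by blast
      have "Poly_Mapping.keys m' = insert x (Poly_Mapping.keys m)"
        unfolding m(1) keys_add_nat by simp
      moreover have "insert x (Poly_Mapping.keys m) = insert x \<sigma>"
        using m(2) unfolding M_def by fastforce
      moreover have "monomial_degree m' = Suc j'"
        using m(2) unfolding m(1) monomial_degree_add monomial_degree_single M_def by auto
      ultimately show "m' \<in> M (insert x \<sigma>) (Suc j')" by (simp add: M_def)
    qed
    moreover have "inj_on (\<lambda>m. m + ?x) (M (insert x \<sigma>) j' \<union> M \<sigma> j')" by (simp add: inj_on_def)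
    ultimately have "card (M (insert x \<sigma>) (Suc j')) = card (M (insert x \<sigma>) j' \<union> M \<sigma> j')"
      by (simp add: card_image)
    also have "\<dots> = card (M (insert x \<sigma>) j') + card (M \<sigma> j')"
      by (rule card_Un_disjoint) (use fin assms in \<open>auto simp: M_def\<close>)
    finally show ?thesis using Suc by (simp add: algebra_simps nth)
  qed
qed

lemma support_series_times:
  "finite \<sigma> \<Longrightarrow> support_series \<sigma> * (1 - fps_X) ^ card \<sigma> = fps_X ^ card \<sigma>"
proof (induction \<sigma> rule: finite_induct)
  case empty
  have "{m :: nat \<Rightarrow>\<^sub>0 nat. Poly_Mapping.keys m = {} \<and> monomial_degree m = j} = (if j = 0 then {0} else {})" for j
    by (auto simp: monomial_degree_def)
  then show ?case by (intro fps_ext) (simp add: support_series_def)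
next
  case (insert x \<sigma>)
  have "support_series (insert x \<sigma>) * (1 - fps_X) ^ card (insert x \<sigma>) =
    (support_series (insert x \<sigma>) * (1 - fps_X)) * (1 - fps_X) ^ card \<sigma>"
    using insert.hyps by (simp add: mult_ac)
  also have "\<dots> = fps_X * (support_series \<sigma> * (1 - fps_X) ^ card \<sigma>)"
    unfolding support_series_insert[OF insert.hyps] by (simp add: mult_ac)
  also have "\<dots> = fps_X ^ card (insert x \<sigma>)" using insert by simp
  finally show ?case .
qed

text \<open>Ensures that the exponents \<open>i - card \<sigma>\<close> in the Hilbert series are
  true differences.\<close>

lemma face_card_le_degree:
  assumes \<Delta>: "simplicial_complex n \<Delta>" and "\<sigma> \<in> \<Delta>"
  shows "card \<sigma> \<le> face_degree \<Delta> \<sigma>"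
proof -
  have "\<not> face_degree \<Delta> \<sigma> < card \<sigma>"
    using face_degree_eq_iff[OF assms, of "face_degree \<Delta> \<sigma>"] \<open>\<sigma> \<in> \<Delta>\<close> by blast
  then show ?thesis by simp
qed

lemma h_U_mono_ideal:
  assumes \<Delta>: "simplicial_complex n \<Delta>" and i: "F\<^sub>0 \<in> \<Delta>" "i \<le> card F\<^sub>0"
  shows "h_U n (mono_ideal n \<Delta> :: 'k::field mpoly set) i =
    (\<Sum>j\<le>i. of_nat (f_number \<Delta> i j) * [:0, 1:] ^ j * (1 - [:0, 1:]) ^ (i - j))"
    (is "_ = ?h")
proof -
  note \<Delta>_fin = simplicial_complex_finite[OF \<Delta>]
  define D where "D = {\<sigma>\<in>\<Delta>. face_degree \<Delta> \<sigma> = i}"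
  have finD: "finite D" using \<Delta>_fin(1) by (simp add: D_def)
  have series: "Abs_fps (\<lambda>j. int (U_dim n (mono_ideal n \<Delta> :: 'k mpoly set) i j)) = (\<Sum>\<sigma>\<in>D. support_series \<sigma>)"
  proof (rule fps_ext)
    fix j
    have "{m. Poly_Mapping.keys m \<in> \<Delta> \<and> face_degree \<Delta> (Poly_Mapping.keys m) = i \<and> monomial_degree m = j} =
      (\<Union>\<sigma>\<in>D. {m. Poly_Mapping.keys m = \<sigma> \<and> monomial_degree m = j})"
      by (auto simp: D_def)
    also have "card \<dots> = (\<Sum>\<sigma>\<in>D. card {m. Poly_Mapping.keys m = \<sigma> \<and> monomial_degree m = j})"
    proof (rule card_UN_disjoint[OF finD])
      show "\<forall>\<sigma>\<in>D. finite {m. Poly_Mapping.keys m = \<sigma> \<and> monomial_degree m = j}"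
      proof
        fix \<sigma> assume "\<sigma> \<in> D"
        then have "finite \<sigma>" using \<Delta>_fin(3) by (simp add: D_def)
        then show "finite {m. Poly_Mapping.keys m = \<sigma> \<and> monomial_degree m = j}"
          by (rule finite_subset[OF _ finite_monomials[of \<sigma> j], rotated]) auto
      qed
    qed auto
    finally show "fps_nth (Abs_fps (\<lambda>j. int (U_dim n (mono_ideal n \<Delta> :: 'k mpoly set) i j))) j =
        fps_nth (\<Sum>\<sigma>\<in>D. support_series \<sigma>) j"
      by (simp add: U_dim_mono_ideal[OF assms] fps_sum_nth support_series_def)
  qed
  have "(\<Sum>\<sigma>\<in>D. support_series \<sigma>) * (1 - fps_X) ^ i = (\<Sum>\<sigma>\<in>D. fps_X ^ card \<sigma> * (1 - fps_X) ^ (i - card \<sigma>))"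
    unfolding sum_distrib_right
  proof (rule sum.cong)
    fix \<sigma> assume "\<sigma> \<in> D"
    then have \<sigma>: "\<sigma> \<in> \<Delta>" "face_degree \<Delta> \<sigma> = i" by (simp_all add: D_def)
    then have "i = card \<sigma> + (i - card \<sigma>)" using face_card_le_degree[OF \<Delta>] by fastforce
    then have "support_series \<sigma> * (1 - fps_X) ^ i =
      (support_series \<sigma> * (1 - fps_X) ^ card \<sigma>) * (1 - fps_X) ^ (i - card \<sigma>)"
      by (metis mult.assoc power_add)
    then show "support_series \<sigma> * (1 - fps_X) ^ i = fps_X ^ card \<sigma> * (1 - fps_X) ^ (i - card \<sigma>)"
      unfolding support_series_times[OF \<Delta>_fin(3)[OF \<sigma>(1)]] .
  qed simp
  \<comment> \<open>The summand depends only on \<open>card \<sigma>\<close>, so collecting faces of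
    equal size produces the numbers \<open>f_number \<Delta> i j\<close>.\<close>
  also have "\<dots> = (\<Sum>j\<le>i. \<Sum>\<sigma>\<in>{\<sigma>\<in>D. card \<sigma> = j}. fps_X ^ card \<sigma> * (1 - fps_X) ^ (i - card \<sigma>))"
    by (rule sum.group[symmetric])
      (use finD face_card_le_degree[OF \<Delta>] in \<open>auto simp: D_def\<close>)
  also have "\<dots> = (\<Sum>j\<le>i. of_nat (f_number \<Delta> i j) * (fps_X ^ j * (1 - fps_X) ^ (i - j)))"
    by (rule sum.cong) (simp_all add: f_number_def D_def)
  also have "\<dots> = fps_of_poly ?h"
  proof -
    have "fps_of_poly (of_nat c) = (of_nat c :: int fps)" for c
      unfolding of_nat_poly fps_of_poly_const by (rule fps_of_nat)
    then show ?thesis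
      by (simp add: fps_of_poly_sum fps_of_poly_mult fps_of_poly_power fps_of_poly_diff mult.assoc)
  qed
  finally have "Abs_fps (\<lambda>j. int (U_dim n (mono_ideal n \<Delta> :: 'k mpoly set) i j)) * (1 - fps_X) ^ i = fps_of_poly ?h"
    unfolding series .
  \<comment> \<open>Polynomials embed injectively into power series, so the description in
    \<open>h_U\<close> has this polynomial as its only solution.\<close>
  then show ?thesis
    unfolding h_U_def by (intro the_equality) simp_all
qed

text \<open>The source of the signed binomials in \<open>h_number\<close>: after the shift by
  \<open>k\<close> they are the coefficients of \<open>(1 - t) ^ (i - k)\<close>.\<close>

lemma coeff_power_times_one_minus:
  assumes "j \<le> i" "k \<le> i"
  shows "coeff ([:0, 1:] ^ k * (1 - [:0, 1:]) ^ (i - k) :: int poly) j =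
    (if k \<le> j then (- 1) ^ (j - k) * int ((i - k) choose (j - k)) else 0)"
proof -
  have "[:0, 1:] ^ k = (monom 1 k :: int poly)" by (simp add: monom_altdef)
  moreover have "1 - [:0, 1:] = ([:1, - 1:] :: int poly)" by (simp add: one_pCons)
  ultimately show ?thesis
    using assms by (auto simp: coeff_monom_mult coeff_linear_poly_power not_less)
qed

theorem theorem10:
  fixes n :: nat and \<Delta> :: "nat set set"
  assumes "simplicial_complex n \<Delta>" and "\<Delta> \<noteq> {}"
  shows "BW n (stanley_reisner_ideal n \<Delta> :: 'k::field mpoly set) =
           (\<Sum>i\<le>n. \<Sum>j\<le>i. of_nat (f_number \<Delta> i j) * w_var ^ i * t_var ^ j * (1 - t_var) ^ (i - j))
       \<and> (\<forall>i j. j \<le> i \<and> int i \<le> complex_dim \<Delta> + 1 \<longrightarrow>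
           h_number \<Delta> i j =
             coeff (coeff (BW n (stanley_reisner_ideal n \<Delta> :: 'k mpoly set)) i) j)"
proof -
  note \<Delta>_fin = simplicial_complex_finite[OF assms(1)]
  define d where "d = Max (card ` \<Delta>)"
  have "d \<in> card ` \<Delta>" unfolding d_def using \<Delta>_fin(1) assms(2) by (intro Max_in) auto
  then obtain F\<^sub>0 where F0: "F\<^sub>0 \<in> \<Delta>" "card F\<^sub>0 = d" by blast
  have card_le: "card F \<le> d" if "F \<in> \<Delta>" for F using \<Delta>_fin(1) that by (simp add: d_def)
  have "d \<le> n" using card_mono[OF _ \<Delta>_fin(2)[OF F0(1)]] F0(2) by simp
  define h where "h i = (\<Sum>j\<le>i. of_nat (f_number \<Delta> i j) * [:0, 1:] ^ j * (1 - [:0, 1:]) ^ (i - j) :: int poly)" for i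
  let ?I = "stanley_reisner_ideal n \<Delta> :: 'k mpoly set"
  have I: "?I = mono_ideal n \<Delta>" by (rule stanley_reisner_ideal_eq[OF assms(1)])
  have "krull_dim (poly_ring n Quot ?I) = enat d"
    unfolding I d_def using krull_dim_mono_ideal[OF \<Delta>_fin(1) assms(2) \<Delta>_fin(2)] .
  \<comment> \<open>The largest face \<open>F\<^sub>0\<close> serves every index
    \<open>i \<le> d\<close> in \<open>h_U_mono_ideal\<close>.\<close>
  then have BW: "BW n ?I = (\<Sum>i\<le>d. [:h i:] * w_var ^ i)"
    unfolding BW_def I h_def using h_U_mono_ideal[OF assms(1) F0(1), where 'k = 'k] F0(2) by simp
  \<comment> \<open>A face degree is the size of some face, so none exceeds \<open>d\<close>; this
    permits the summation to run to \<open>n\<close>.\<close>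
  have f0: "f_number \<Delta> i j = 0" if "d < i" for i j
  proof -
    have "face_degree \<Delta> \<sigma> \<noteq> i" if "\<sigma> \<in> \<Delta>" for \<sigma>
      using face_degree_eq_iff[OF assms(1) that, of i] card_le \<open>d < i\<close> by fastforce
    then show ?thesis unfolding f_number_def by (metis (mono_tags, lifting) card.empty empty_Collect_eq)
  qed
  have summand: "[:h i:] * w_var ^ i =
    (\<Sum>j\<le>i. of_nat (f_number \<Delta> i j) * w_var ^ i * t_var ^ j * (1 - t_var) ^ (i - j))" for i
  proof -
    have sum: "[:sum g A:] = (\<Sum>a\<in>A. [:g a:])" for g :: "nat \<Rightarrow> int poly" and A
      by (rule poly_eqI) (simp add: coeff_sum coeff_pCons split: nat.split)
    have "1 - t_var = [:1 - [:0, 1:]:]" by (simp add: one_pCons)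
    then have "[:of_nat c * [:0, 1:] ^ j * (1 - [:0, 1:]) ^ (i - j):] = of_nat c * t_var ^ j * (1 - t_var) ^ (i - j)" for c j
      by (simp add: poly_const_pow of_nat_poly mult.commute)
    then show ?thesis
      unfolding h_def sum by (simp add: sum_distrib_left mult_ac)
  qed
  have "(\<Sum>i\<le>d. [:h i:] * w_var ^ i) = (\<Sum>i\<le>n. [:h i:] * w_var ^ i)"
    by (rule sum.mono_neutral_left) (use \<open>d \<le> n\<close> f0 in \<open>auto simp: h_def\<close>)
  then have 1: "BW n ?I = (\<Sum>i\<le>n. \<Sum>j\<le>i. of_nat (f_number \<Delta> i j) * w_var ^ i * t_var ^ j * (1 - t_var) ^ (i - j))"
    unfolding BW summand .
  have 2: "h_number \<Delta> i j = coeff (coeff (BW n ?I) i) j" if ji: "j \<le> i" and i: "int i \<le> complex_dim \<Delta> + 1" for i j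
  proof -
    have "complex_dim \<Delta> \<in> (\<lambda>F. int (card F) - 1) ` \<Delta>"
      unfolding complex_dim_def using \<Delta>_fin(1) assms(2) by (intro Max_in) auto
    \<comment> \<open>The integer dimension is \<open>card F - 1\<close> for some face
      \<open>F\<close>, so adding 1 gives a face size, which is at most \<open>d\<close>.\<close>
    then have "i \<le> d" using i card_le by fastforce
    have "[:h i:] * w_var ^ i = monom (h i) i" for i by (simp add: monom_altdef)
    then have "coeff (BW n ?I) i = h i"
      unfolding BW using \<open>i \<le> d\<close> by (simp add: coeff_sum)
    then have "coeff (coeff (BW n ?I) i) j =
      (\<Sum>k\<le>i. int (f_number \<Delta> i k) * coeff ([:0, 1:] ^ k * (1 - [:0, 1:]) ^ (i - k)) j)"
      by (simp add: h_def coeff_sum mult.assoc of_nat_poly)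
    also have "\<dots> = (\<Sum>k\<le>i. if k \<le> j then int (f_number \<Delta> i k) * ((- 1) ^ (j - k) * int ((i - k) choose (j - k))) else 0)"
      by (rule sum.cong) (use coeff_power_times_one_minus[OF ji] in auto)
    \<comment> \<open>Terms with \<open>k > j\<close> drop out since \<open>t ^ k\<close>
      contributes nothing in degree \<open>j\<close>.\<close>
    also have "\<dots> = (\<Sum>k\<le>j. int (f_number \<Delta> i k) * ((- 1) ^ (j - k) * int ((i - k) choose (j - k))))"
      by (rule sum.mono_neutral_cong_right) (use ji in auto)
    also have "\<dots> = h_number \<Delta> i j" by (simp add: h_number_def mult_ac)
    finally show ?thesis by simp
  qed
  show ?thesis using 1 2 by blast
qed

end
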